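(* Let $(a,b,c)\in\mathbb R^3\setminus\{(0,0,0)\}$, let $(N(2,1)_{a,b,c},\eta,F_1,F_2,F_3)$ be the compact $SU(2)$-nilmanifold described in the context, with torsion $3$-form $T=\eta\wedge d\eta$ and Levi-Civita connection $\nabla^g$, and let $A_{\lambda,\mu,\tau}$ be the $SU(2)$-instanton described in the context. Let $(\lambda,\mu,\tau)\ne(0,0,0)$ be such that $\lambda^2+\mu^2+\tau^2<\frac38(a^2+b^2+c^2)$. Then $$dT=2\pi^2\alpha'\big(p_1(\nabla^g)-p_1(A_{\lambda,\mu,\tau})\big),\qquad\text{where }\ \alpha'=16\big(3(a^2+b^2+c^2)-8(\lambda^2+\mu^2+\tau^2)\big)^{-1}>0.$$ Therefore $((N(2,1)_{a,b,c},\eta,F_1,F_2,F_3),A_{\lambda,\mu,\tau},\nabla^g)$, with flux $H=T$, constant dilaton $\phi$ and gauge connection $A=A_{\lambda,\mu,\tau}$ on the tangent bundle, is a compact solution to the heterotic supersymmetry equations, i.e. there is a nowhere-vanishing spinor field $\epsilon$ with $$\nabla^+\epsilon=0,\qquad \Big(\Gamma^m\partial_m\phi-\tfrac1{12}H_{mnp}\Gamma^{mnp}\Big)\epsilon=0,\qquad F^A_{mn}\Gamma^{mn}\epsilon=0,$$ satisfying the anomaly cancellation condition $$dH=\frac{\alpha'}4\,8\pi^2\big(p_1(\nabla^g)-p_1(A_{\lambda,\mu,\tau})\big).$$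
   Context: $H(2,1)$ is the group of real matrices $\begin{pmatrix}1&x_1&x_2&z\\0&1&0&y_1\\0&0&1&y_2\\0&0&0&1\end{pmatrix}$, $\Gamma(2,1)$ the subgroup of matrices with integer entries, $N(2,1)=\Gamma(2,1)\backslash H(2,1)$. For $(a,b,c)\ne(0,0,0)$ let $e^1,\dots,e^5$ be a basis of left-invariant $1$-forms on $H(2,1)$ (descending to $N(2,1)$) with $$de^1=de^2=de^3=de^4=0,\qquad de^5=a(e^{12}-e^{34})+b(e^{13}+e^{24})+c(e^{14}-e^{23}),\qquad e^{ij}=e^i\wedge e^j.$$ The $SU(2)$-structure is $\eta=e^5$, $F_1=e^{12}+e^{34}$, $F_2=e^{13}+e^{42}$, $F_3=e^{14}+e^{23}$, with metric $g=\sum_{i=1}^5e^i\otimes e^i$; $N(2,1)$ with this structure is $N(2,1)_{a,b,c}$. $E_1,\dots,E_5$ is the dual frame. $\nabla^+$ is defined by $g(\nabla^+_XY,Z)=g(\nabla^g_XY,Z)+\frac12H(X,Y,Z)$, and $\nabla^+\epsilon$ is the induced derivative on spinors. $\Gamma^m$ are gamma matrices with $\Gamma^m\Gamma^n+\Gamma^n\Gamma^m=2g^{mn}$; $\Gamma^{mn},\Gamma^{mnp}$ are antisymmetrized products; repeated indices are summed. Connection forms are given by $\nabla_XE_j=\sigma^s_j(X)E_s$, curvature forms by $\Omega^i_j=d\sigma^i_j+\sigma^i_k\wedge\sigma^k_j$, and $p_1(\nabla)=\frac1{8\pi^2}\sum_{1\le i<j\le5}\Omega^i_j\wedge\Omega^i_j$.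 $A_{\lambda,\mu,\tau}$ is the linear connection with $$\sigma^1_2=-\sigma^2_1=-\sigma^3_4=\sigma^4_3=-\lambda e^5,\quad \sigma^1_3=-\sigma^3_1=\sigma^2_4=-\sigma^4_2=-\mu e^5,\quad \sigma^1_4=-\sigma^4_1=-\sigma^2_3=\sigma^3_2=-\tau e^5,$$ and all other $\sigma^i_j=0$; $F^A$ is its curvature, and $F^A_{mn}$ are the components of its curvature $2$-form in the form indices. *)

theory Defs
  imports
    "HOL-Analysis.Analysis"
    "HOL-Algebra.Coset"
    "HOL-Combinatorics.Combinatorics"
begin

text \<open>
  A map on a finite-dimensional space is of class \<open>C\<^sup>k\<^sup>+\<^sup>1\<close> iff it is differentiable and all its
  directional derivatives along constant vectors are of class \<open>C\<^sup>k\<close>.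
\<close>

fun C_diff :: "nat \<Rightarrow> ('a::euclidean_space \<Rightarrow> 'b::real_normed_vector) \<Rightarrow> bool" where
  "C_diff 0 f \<longleftrightarrow> continuous_on UNIV f"
| "C_diff (Suc k) f \<longleftrightarrow>
     f differentiable_on UNIV \<and> (\<forall>v. C_diff k (\<lambda>p. frechet_derivative f (at p) v))"

definition smooth :: "('a::euclidean_space \<Rightarrow> 'b::real_normed_vector) \<Rightarrow> bool" where
  "smooth f \<longleftrightarrow> (\<forall>k. C_diff k f)"

text \<open>
  A differential \<open>k\<close>-form is evaluated on a list of \<open>k\<close> tangent vectors.  By convention a
  \<open>k\<close>-form vanishes on lists of any other length, so that equality of forms is equality of functions.
\<close>

type_synonym 'a form = "'a \<Rightarrow> 'a list \<Rightarrow> real"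
type_synonym 'a vfield = "'a \<Rightarrow> 'a"
type_synonym 'a connection = "'a vfield \<Rightarrow> 'a vfield \<Rightarrow> 'a vfield"

definition one_form :: "'a::euclidean_space form \<Rightarrow> bool" where
  "one_form w \<longleftrightarrow>
     (\<forall>p. linear (\<lambda>v. w p [v])) \<and> (\<forall>v. smooth (\<lambda>p. w p [v])) \<and>
     (\<forall>p vs. length vs \<noteq> 1 \<longrightarrow> w p vs = 0)"

text \<open>
  The normalisation is \<open>(\<alpha> \<and> \<beta>)(u, v) = \<alpha>(u) \<beta>(v) - \<alpha>(v) \<beta>(u)\<close> for \<open>1\<close>-forms, and
  \<open>d\<alpha>(X, Y) = X \<alpha>(Y) - Y \<alpha>(X) - \<alpha>([X, Y])\<close>.  Since the vectors \<open>vs\<close> below are constant, no bracket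
  terms occur in the invariant formula for the exterior derivative.
\<close>

definition wedge ::
  "nat \<Rightarrow> nat \<Rightarrow> 'a form \<Rightarrow> 'a form \<Rightarrow> 'a::euclidean_space form" where
  "wedge k l w u = (\<lambda>p vs. if length vs = k + l then
     (\<Sum>\<pi> | \<pi> permutes {..<k + l}. real_of_int (sign \<pi>)
        * w p (take k (permute_list \<pi> vs)) * u p (drop k (permute_list \<pi> vs)))
     / (fact k * fact l) else 0)"

definition ext_d :: "'a form \<Rightarrow> 'a::euclidean_space form" where
  "ext_d w = (\<lambda>p vs. \<Sum>i<length vs. (-1) ^ i *
     frechet_derivative (\<lambda>q. w q (take i vs @ drop (Suc i) vs)) (at p) (vs ! i))"

definition lie_bracket :: "'a::euclidean_space vfield \<Rightarrow> 'a vfield \<Rightarrow> 'a vfield" where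
  "lie_bracket X Y = (\<lambda>p. frechet_derivative Y (at p) (X p) - frechet_derivative X (at p) (Y p))"

definition linear_connection :: "'a::euclidean_space connection \<Rightarrow> bool" where
  "linear_connection nab \<longleftrightarrow>
     (\<forall>X Y. smooth X \<longrightarrow> smooth Y \<longrightarrow> smooth (nab X Y)) \<and>
     (\<forall>X X' Y. smooth X \<longrightarrow> smooth X' \<longrightarrow> smooth Y \<longrightarrow>
        nab (\<lambda>p. X p + X' p) Y = (\<lambda>p. nab X Y p + nab X' Y p)) \<and>
     (\<forall>(f :: 'a \<Rightarrow> real) X Y. smooth f \<longrightarrow> smooth X \<longrightarrow> smooth Y \<longrightarrow>
        nab (\<lambda>p. f p *\<^sub>R X p) Y = (\<lambda>p. f p *\<^sub>R nab X Y p)) \<and>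
     (\<forall>X Y Y'. smooth X \<longrightarrow> smooth Y \<longrightarrow> smooth Y' \<longrightarrow>
        nab X (\<lambda>p. Y p + Y' p) = (\<lambda>p. nab X Y p + nab X Y' p)) \<and>
     (\<forall>(f :: 'a \<Rightarrow> real) X Y. smooth f \<longrightarrow> smooth X \<longrightarrow> smooth Y \<longrightarrow>
        nab X (\<lambda>p. f p *\<^sub>R Y p) =
          (\<lambda>p. frechet_derivative f (at p) (X p) *\<^sub>R Y p + f p *\<^sub>R nab X Y p))"

definition levi_civita ::
  "('a \<Rightarrow> 'a \<Rightarrow> 'a \<Rightarrow> real) \<Rightarrow> 'a::euclidean_space connection \<Rightarrow> bool" where
  "levi_civita g nab \<longleftrightarrow> linear_connection nab \<and>
     (\<forall>X Y Z. smooth X \<longrightarrow> smooth Y \<longrightarrow> smooth Z \<longrightarrow> (\<forall>p.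
        frechet_derivative (\<lambda>q. g q (Y q) (Z q)) (at p) (X p) =
          g p (nab X Y p) (Z p) + g p (Y p) (nab X Z p))) \<and>
     (\<forall>X Y. smooth X \<longrightarrow> smooth Y \<longrightarrow> (\<forall>p.
        nab X Y p - nab Y X p = lie_bracket X Y p))"

text \<open>The vector \<open>w\<close> below exists and is unique because \<open>g\<close> is nondegenerate.\<close>

definition nabla_plus ::
  "('a \<Rightarrow> 'a \<Rightarrow> 'a \<Rightarrow> real) \<Rightarrow> 'a form \<Rightarrow> 'a connection \<Rightarrow> 'a::euclidean_space connection" where
  "nabla_plus g H nabg = (\<lambda>X Y p. THE w.
     \<forall>z. g p w z = g p (nabg X Y p) z + 1/2 * H p [X p, Y p, z])"

text \<open>
  The group is a matrix group; differential calculus on it is done in the global chart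
  \<open>heis_mat\<close>, with coordinates \<open>(x\<^sub>1, x\<^sub>2, y\<^sub>1, y\<^sub>2, z)\<close>.
\<close>

type_synonym coords = "real \<times> real \<times> real \<times> real \<times> real"

fun heis_mat :: "coords \<Rightarrow> real^4^4" where
  "heis_mat (x1, x2, y1, y2, z) = vector
     [vector [1, x1, x2, z],
      vector [0, 1,  0,  y1],
      vector [0, 0,  1,  y2],
      vector [0, 0,  0,  1]]"

definition heis_coords :: "real^4^4 \<Rightarrow> coords" where
  "heis_coords M = (M$1$2, M$1$3, M$2$4, M$3$4, M$1$4)"

definition Heis :: "(real^4^4) monoid" where
  "Heis = \<lparr>carrier = range heis_mat, monoid.mult = (**), one = mat 1\<rparr>"

definition Heis_int :: "(real^4^4) set" where
  "Heis_int = {M \<in> carrier Heis. \<forall>i j. M$i$j \<in> \<int>}"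

definition N21 :: "(real^4^4) set set" where
  "N21 = rcosets\<^bsub>Heis\<^esub> Heis_int"

definition proj_mat :: "real^4^4 \<Rightarrow> (real^4^4) set" where
  "proj_mat M = Heis_int #>\<^bsub>Heis\<^esub> M"

definition proj :: "coords \<Rightarrow> (real^4^4) set" where
  "proj p = proj_mat (heis_mat p)"

definition N21_topology :: "(real^4^4) set topology" where
  "N21_topology = topology (\<lambda>U. U \<subseteq> N21 \<and>
     openin (top_of_set (carrier Heis)) {M \<in> carrier Heis. proj_mat M \<in> U})"

definition left_trans :: "real^4^4 \<Rightarrow> coords \<Rightarrow> coords" where
  "left_trans M p = heis_coords (M ** heis_mat p)"

definition left_invariant :: "coords form \<Rightarrow> bool" where
  "left_invariant w \<longleftrightarrow> (\<forall>M\<in>carrier Heis. \<forall>p vs.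
     w (left_trans M p) (map (frechet_derivative (left_trans M) (at p)) vs) = w p vs)"

text \<open>
  Coframes and frames are indexed by \<open>{1..5}\<close>.  Tensors on \<open>N(2,1)\<close> are represented by their
  (invariant) pullbacks to \<open>H(2,1)\<close>.
\<close>

definition left_invariant_basis :: "(nat \<Rightarrow> coords form) \<Rightarrow> bool" where
  "left_invariant_basis e \<longleftrightarrow>
     (\<forall>i\<in>{1..5}. one_form (e i) \<and> left_invariant (e i)) \<and>
     (\<forall>c :: nat \<Rightarrow> real. (\<forall>p vs. (\<Sum>i=1..5. c i * e i p vs) = 0) \<longrightarrow> (\<forall>i\<in>{1..5}. c i = 0)) \<and>
     (\<forall>w. one_form w \<and> left_invariant w \<longrightarrow>
        (\<exists>c :: nat \<Rightarrow> real. \<forall>p vs. w p vs = (\<Sum>i=1..5. c i * e i p vs)))"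

definition e2 :: "(nat \<Rightarrow> coords form) \<Rightarrow> nat \<Rightarrow> nat \<Rightarrow> coords form" where
  "e2 e i j = wedge 1 1 (e i) (e j)"

definition N21_coframe :: "real \<Rightarrow> real \<Rightarrow> real \<Rightarrow> (nat \<Rightarrow> coords form) \<Rightarrow> bool" where
  "N21_coframe a b c e \<longleftrightarrow> left_invariant_basis e \<and>
     (\<forall>i\<in>{1..4}. \<forall>p vs. ext_d (e i) p vs = 0) \<and>
     (\<forall>p vs. ext_d (e 5) p vs =
        a * (e2 e 1 2 p vs - e2 e 3 4 p vs) +
        b * (e2 e 1 3 p vs + e2 e 2 4 p vs) +
        c * (e2 e 1 4 p vs - e2 e 2 3 p vs))"

definition su2_adapted ::
  "(nat \<Rightarrow> coords form) \<Rightarrow> coords form \<Rightarrow> coords form \<Rightarrow> coords form \<Rightarrow> coords form \<Rightarrow> bool" where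
  "su2_adapted e eta F1 F2 F3 \<longleftrightarrow>
     eta = e 5 \<and>
     F1 = (\<lambda>p vs. e2 e 1 2 p vs + e2 e 3 4 p vs) \<and>
     F2 = (\<lambda>p vs. e2 e 1 3 p vs + e2 e 4 2 p vs) \<and>
     F3 = (\<lambda>p vs. e2 e 1 4 p vs + e2 e 2 3 p vs)"

definition coframe_metric :: "(nat \<Rightarrow> coords form) \<Rightarrow> coords \<Rightarrow> coords \<Rightarrow> coords \<Rightarrow> real" where
  "coframe_metric e p u v = (\<Sum>i=1..5. e i p [u] * e i p [v])"

definition dual_frame :: "(nat \<Rightarrow> coords form) \<Rightarrow> nat \<Rightarrow> coords vfield" where
  "dual_frame e i p = (THE v. \<forall>j\<in>{1..5}. e j p [v] = (if j = i then 1 else 0))"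

text \<open>
  The forms \<open>\<sigma>\<^sup>s\<^sub>j\<close> with \<open>\<nabla>\<^sub>X E\<^sub>j = \<sigma>\<^sup>s\<^sub>j(X) E\<^sub>s\<close>.  As a connection is tensorial in the direction \<open>X\<close>,
  a tangent vector may be extended to a constant field in the chart.
\<close>

definition conn_form ::
  "(nat \<Rightarrow> coords form) \<Rightarrow> coords connection \<Rightarrow> nat \<Rightarrow> nat \<Rightarrow> coords form" where
  "conn_form e nab s j = (\<lambda>p vs. if length vs = 1 then
     e s p [nab (\<lambda>_. hd vs) (dual_frame e j) p] else 0)"

definition curv_form ::
  "(nat \<Rightarrow> coords form) \<Rightarrow> coords connection \<Rightarrow> nat \<Rightarrow> nat \<Rightarrow> coords form" where
  "curv_form e nab i j = (\<lambda>p vs. ext_d (conn_form e nab i j) p vs +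
     (\<Sum>k=1..5. wedge 1 1 (conn_form e nab i k) (conn_form e nab k j) p vs))"

definition pontrjagin1 :: "(nat \<Rightarrow> coords form) \<Rightarrow> coords connection \<Rightarrow> coords form" where
  "pontrjagin1 e nab = (\<lambda>p vs. 1 / (8 * pi\<^sup>2) *
     (\<Sum>j=1..5. \<Sum>i=1..<j. wedge 2 2 (curv_form e nab i j) (curv_form e nab i j) p vs))"

definition instanton_coeff :: "real \<Rightarrow> real \<Rightarrow> real \<Rightarrow> nat \<Rightarrow> nat \<Rightarrow> real" where
  "instanton_coeff lam mu tau i j =
     (if (i, j) \<in> {(1, 2), (4, 3)} then - lam
      else if (i, j) \<in> {(2, 1), (3, 4)} then lam
      else if (i, j) \<in> {(1, 3), (2, 4)} then - mu
      else if (i, j) \<in> {(3, 1), (4, 2)} then mu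
      else if (i, j) \<in> {(1, 4), (3, 2)} then - tau
      else if (i, j) \<in> {(4, 1), (2, 3)} then tau
      else 0)"

definition instanton_connection ::
  "(nat \<Rightarrow> coords form) \<Rightarrow> real \<Rightarrow> real \<Rightarrow> real \<Rightarrow> coords connection \<Rightarrow> bool" where
  "instanton_connection e lam mu tau A \<longleftrightarrow> linear_connection A \<and>
     (\<forall>i\<in>{1..5}. \<forall>j\<in>{1..5}. \<forall>p vs.
        conn_form e A i j p vs = instanton_coeff lam mu tau i j * e 5 p vs)"

text \<open>Indices refer to the orthonormal frame, so \<open>g\<^sup>m\<^sup>n\<close> is the Kronecker symbol.\<close>

definition gamma_matrices :: "(nat \<Rightarrow> complex^4^4) \<Rightarrow> bool" where
  "gamma_matrices G \<longleftrightarrow> (\<forall>m\<in>{1..5}. \<forall>n\<in>{1..5}.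
     G m ** G n + G n ** G m = (if m = n then mat 2 else 0))"

definition gamma_asym :: "(nat \<Rightarrow> complex^4^4) \<Rightarrow> nat list \<Rightarrow> complex^4^4" where
  "gamma_asym G ms = (1 / fact (length ms)) *\<^sub>R
     (\<Sum>\<pi> | \<pi> permutes {..<length ms}. real_of_int (sign \<pi>) *\<^sub>R
        foldr (\<lambda>m M. G m ** M) (permute_list \<pi> ms) (mat 1))"

text \<open>
  An \<open>SU(2)\<close>-structure determines a spin structure, whose spinor bundle is trivialised by the
  global adapted coframe.  A spinor field is thus a map from the nilmanifold to \<open>\<complex>\<^sup>4\<close>, and a metric
  connection induces \<open>\<nabla>\<^sub>X \<epsilon> = X(\<epsilon>) + \<sigma>\<^sup>i\<^sub>j(X) \<Gamma>\<^sup>i\<^sup>j \<epsilon> / 4\<close>.  With \<open>\<Gamma>\<^sup>m \<Gamma>\<^sup>n + \<Gamma>\<^sup>n \<Gamma>\<^sup>m = 2 g\<^sup>m\<^sup>n\<close>, this sign makes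
  Clifford multiplication parallel.
\<close>

type_synonym spinor = "(real^4^4) set \<Rightarrow> complex^4"

definition spin_deriv ::
  "(nat \<Rightarrow> coords form) \<Rightarrow> (nat \<Rightarrow> complex^4^4) \<Rightarrow> coords connection \<Rightarrow> spinor \<Rightarrow>
   coords \<Rightarrow> coords \<Rightarrow> complex^4" where
  "spin_deriv e G nab eps p v =
     frechet_derivative (\<lambda>q. eps (proj q)) (at p) v +
     (1/4) *\<^sub>R (\<Sum>i=1..5. \<Sum>j=1..5.
        conn_form e nab i j p [v] *\<^sub>R (gamma_asym G [i, j] *v eps (proj p)))"

definition gravitino_eq ::
  "(nat \<Rightarrow> coords form) \<Rightarrow> (nat \<Rightarrow> complex^4^4) \<Rightarrow> coords connection \<Rightarrow> coords form \<Rightarrow>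
   spinor \<Rightarrow> bool" where
  "gravitino_eq e G nabg H eps \<longleftrightarrow>
     (\<forall>p v. spin_deriv e G (nabla_plus (coframe_metric e) H nabg) eps p v = 0)"

definition dilatino_eq ::
  "(nat \<Rightarrow> coords form) \<Rightarrow> (nat \<Rightarrow> complex^4^4) \<Rightarrow> ((real^4^4) set \<Rightarrow> real) \<Rightarrow> coords form \<Rightarrow>
   spinor \<Rightarrow> bool" where
  "dilatino_eq e G phi H eps \<longleftrightarrow> (\<forall>p.
     ((\<Sum>m=1..5. frechet_derivative (\<lambda>q. phi (proj q)) (at p) (dual_frame e m p) *\<^sub>R G m) -
      (1/12) *\<^sub>R (\<Sum>m=1..5. \<Sum>n=1..5. \<Sum>k=1..5.
         H p [dual_frame e m p, dual_frame e n p, dual_frame e k p] *\<^sub>R gamma_asym G [m, n, k]))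
     *v eps (proj p) = 0)"

text \<open>The gaugino equation holds for each endomorphism component \<open>(F\<^sup>A)\<^sup>i\<^sub>j\<close>.\<close>

definition gaugino_eq ::
  "(nat \<Rightarrow> coords form) \<Rightarrow> (nat \<Rightarrow> complex^4^4) \<Rightarrow> coords connection \<Rightarrow> spinor \<Rightarrow> bool" where
  "gaugino_eq e G A eps \<longleftrightarrow> (\<forall>p. \<forall>i\<in>{1..5}. \<forall>j\<in>{1..5}.
     (\<Sum>m=1..5. \<Sum>n=1..5. curv_form e A i j p [dual_frame e m p, dual_frame e n p] *\<^sub>R
        gamma_asym G [m, n]) *v eps (proj p) = 0)"

text \<open>
  \<open>nab\<close> is the connection in the anomaly cancellation condition; the Levi-Civita connection
  \<open>nabg\<close> enters the gravitino equation.
\<close>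

definition compact_heterotic_solution ::
  "(nat \<Rightarrow> coords form) \<Rightarrow> coords form \<Rightarrow> coords form \<Rightarrow> coords form \<Rightarrow> coords form \<Rightarrow>
   coords connection \<Rightarrow> coords connection \<Rightarrow> coords connection \<Rightarrow>
   coords form \<Rightarrow> ((real^4^4) set \<Rightarrow> real) \<Rightarrow> real \<Rightarrow> (nat \<Rightarrow> complex^4^4) \<Rightarrow> bool" where
  "compact_heterotic_solution e eta F1 F2 F3 A nab nabg H phi alpha' G \<longleftrightarrow>
     topspace N21_topology = N21 \<and> compact_space N21_topology \<and>
     su2_adapted e eta F1 F2 F3 \<and>
     levi_civita (coframe_metric e) nabg \<and> linear_connection nab \<and> linear_connection A \<and>
     smooth (\<lambda>p. phi (proj p)) \<and>
     (\<exists>eps :: spinor. smooth (\<lambda>p. eps (proj p)) \<and> (\<forall>x\<in>N21. eps x \<noteq> 0) \<and>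
        gravitino_eq e G nabg H eps \<and>
        dilatino_eq e G phi H eps \<and>
        gaugino_eq e G A eps) \<and>
     (\<forall>p vs. ext_d H p vs =
        alpha' / 4 * (8 * pi\<^sup>2) * (pontrjagin1 e nab p vs - pontrjagin1 e A p vs))"

end

(*
  Left-invariance makes everything explicit in the chart: if B p v denotes the twist of the group law
  p * q = p + q + B p q, then e^k_p(v) = e^k_0(v - B p v) and E_j(p) = E_j(0) + B p (E_j(0)), so the
  coframe and the frame are affine in p and de^5 is constant.  With Om_ij the components of de^5, the
  metric and torsion conditions give the Levi-Civita forms
    2 sigma^k_j = Om_jk e^5 - delta_k5 de^5(., E_j) + delta_j5 de^5(., E_k),
  and adding T/2 leaves Om_jk e^5 for nabla^+.  Hence the connection nabla^+, the flux and the
  instanton curvature act on spinors through the anti-self-dual form de^5, which annihilates the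
  spinors with Gamma^1234 eps = -eps; a constant spinor of this kind solves the three equations.
  The squares of the curvature forms are Pfaffians times e^1234, which gives
    p_1(nabla^g) = -3 s^2 / (16 pi^2) e^1234,  p_1(A) = -L s / (2 pi^2) e^1234,  dT = -2 s e^1234
  with s = a^2 + b^2 + c^2 and L = lam^2 + mu^2 + tau^2.
*)
theory Submission
  imports Defs
begin

section \<open>Sums and wedge products of low order\<close>

text \<open>Frame indices are numerals and points are five-tuples: \<open>1\<close> must not become
  \<open>Suc 0\<close>, and quantifiers over points must not be split into coordinates.\<close>

declare One_nat_def [simp del] split_paired_All [simp del] split_paired_Ex [simp del]

lemma sum_1_to_5: "(\<Sum>i=1..5. f i) = f 1 + f 2 + f 3 + f 4 + f (5::nat)"
proof -
  have "{1..5::nat} = {1,2,3,4,5}" by auto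
  then show ?thesis by (simp add: add.assoc)
qed

lemma ball_1_to_5: "(\<forall>i\<in>{1..5}. P i) \<longleftrightarrow> P 1 \<and> P 2 \<and> P 3 \<and> P 4 \<and> P (5::nat)"
proof -
  have "{1..5::nat} = {1,2,3,4,5}" by auto
  then show ?thesis by simp
qed

lemma sum_pairs_below_5:
  "(\<Sum>j=1..5. \<Sum>i=1..<j. f i j) = f 1 2 + (f 1 3 + f 2 3) + (f 1 4 + f 2 4 + f 3 4)
     + (f 1 5 + f 2 5 + f 3 5 + f 4 (5::nat))"
proof -
  have "{1..<1::nat} = {}" "{1..<2::nat} = {1}" "{1..<3::nat} = {1,2}" "{1..<4::nat} = {1,2,3}"
    "{1..<5::nat} = {1,2,3,4}" by auto
  then show ?thesis unfolding sum_1_to_5 by (simp add: add.assoc)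
qed

text \<open>Vector-valued, so that this and the next expansion serve wedge products as well as
  antisymmetrized products of gamma matrices.\<close>

lemma sum_permutations_2:
  "(\<Sum>\<pi> | \<pi> permutes {..<2::nat}. real_of_int (sign \<pi>) *\<^sub>R F (permute_list \<pi> [x,y])) =
     F [x,y] - (F [y,x] :: 'b::real_vector)"
proof -
  have s: "{..<2::nat} = insert 0 {1}" by auto
  have f: "finite {1::nat}" "0 \<notin> {1::nat}" by auto
  show ?thesis unfolding s sum_over_permutations_insert[OF f] permutes_sing
    by (simp add: sign_swap_id sign_id permute_list_def transpose_def upt_rec numeral_2_eq_2 One_nat_def)
qed

lemma sum_permutations_3:
  "(\<Sum>\<pi> | \<pi> permutes {..<3::nat}. real_of_int (sign \<pi>) *\<^sub>R F (permute_list \<pi> [x,y,z])) =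
     F [x,y,z] - F [x,z,y] - F [y,x,z] + F [y,z,x] + F [z,x,y] - (F [z,y,x] :: 'b::real_vector)"
proof -
  have s: "{..<3::nat} = insert 0 (insert 1 {2})" by auto
  have f: "finite {2::nat}" "1 \<notin> {2::nat}" 
     "finite {1,2::nat}" "0 \<notin> {1,2::nat}" by auto
  show ?thesis unfolding s sum_over_permutations_insert[OF f(3,4)] sum_over_permutations_insert[OF f(1,2)] permutes_sing
    by (simp add: sign_swap_id sign_id sign_compose permutation_swap_id permutation_compose
      permute_list_def transpose_def upt_rec numeral_2_eq_2 One_nat_def numeral_3_eq_3)
qed

lemma sum_permutations_4:
  "(\<Sum>\<pi> | \<pi> permutes {..<4::nat}. real_of_int (sign \<pi>) *\<^sub>R F (permute_list \<pi> [x,y,z,w])) =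
     F [x,y,z,w] - F [x,y,w,z] - F [x,z,y,w] + F [x,z,w,y] + F [x,w,y,z] - F [x,w,z,y]
   - F [y,x,z,w] + F [y,x,w,z] + F [y,z,x,w] - F [y,z,w,x] - F [y,w,x,z] + F [y,w,z,x]
   + F [z,x,y,w] - F [z,x,w,y] - F [z,y,x,w] + F [z,y,w,x] + F [z,w,x,y] - F [z,w,y,x]
   - F [w,x,y,z] + F [w,x,z,y] + F [w,y,x,z] - F [w,y,z,x] - F [w,z,x,y] + (F [w,z,y,x] :: 'b::real_vector)"
proof -
  have s: "{..<4::nat} = insert 0 (insert 1 (insert 2 {3}))" by auto
  have f: "finite {3::nat}" "2 \<notin> {3::nat}" 
     "finite {2,3::nat}" "1 \<notin> {2,3::nat}"
     "finite {1,2,3::nat}" "0 \<notin> {1,2,3::nat}" by auto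
  show ?thesis unfolding s sum_over_permutations_insert[OF f(5,6)] sum_over_permutations_insert[OF f(3,4)] sum_over_permutations_insert[OF f(1,2)] permutes_sing
    by (simp add: sign_swap_id sign_id sign_compose permutation_swap_id permutation_compose
      permute_list_def transpose_def upt_rec numeral_eq_Suc One_nat_def)
qed

lemma wedge_eq_0: "length vs \<noteq> k + l \<Longrightarrow> wedge k l w u p vs = 0"
  by (simp add: wedge_def)

lemma wedge_1_1: "wedge 1 1 w u p [x,y] = w p [x] * u p [y] - w p [y] * u p [x]"
  using sum_permutations_2[of "\<lambda>vs. w p (take 1 vs) * u p (drop 1 vs)" x y]
  by (simp add: wedge_def mult.assoc take_Cons drop_Cons split: nat.splits)

text \<open>By antisymmetry of \<open>u\<close> the six permutations give each of three shuffles
  twice, which cancels \<open>fact 1 * fact 2\<close>.\<close>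

lemma wedge_1_2:
  assumes "\<And>x y. u p [y,x] = - u p [x,y]"
  shows "wedge 1 2 w u p [x,y,z] = w p [x] * u p [y,z] - w p [y] * u p [x,z] + w p [z] * u p [x,y]"
  using sum_permutations_3[of "\<lambda>vs. w p (take 1 vs) * u p (drop 1 vs)" x y z]
    assms[of y x] assms[of z x] assms[of z y]
  by (simp add: wedge_def mult.assoc numeral_3_eq_3 One_nat_def)

text \<open>The 24 permutations give each of six shuffles four times, which cancels
  \<open>fact 2 * fact 2\<close>; complementary shuffles agree because both factors are
  \<open>u\<close>, whence the 2.\<close>

lemma wedge_2_2_self:
  assumes "\<And>x y. u p [y,x] = - u p [x,y]"
  shows "wedge 2 2 u u p [x,y,z,w] =
    2 * (u p [x,y] * u p [z,w] - u p [x,z] * u p [y,w] + u p [x,w] * u p [y,z])"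
  using sum_permutations_4[of "\<lambda>vs. u p (take 2 vs) * u p (drop 2 vs)" x y z w]
    assms[of y x] assms[of z x] assms[of z y] assms[of w x] assms[of w y] assms[of w z]
  by (simp add: wedge_def mult.assoc fact_numeral)

section \<open>The Heisenberg group and its compact quotient\<close>

lemma C_diff_const: "C_diff k (\<lambda>p. c)"
  by (induction k arbitrary: c) auto

lemma smooth_const: "smooth (\<lambda>p. c)"
  by (simp add: smooth_def C_diff_const)

text \<open>The derivative is the same at every point, so \<open>C_diff_const\<close> settles all
  higher orders.\<close>

lemma smooth_affine:
  fixes L :: "'a::euclidean_space \<Rightarrow> 'b::real_normed_vector"
  assumes "bounded_linear L"
  shows "smooth (\<lambda>p. c + L p)"
  unfolding smooth_def
proof
  fix k
  have d: "((\<lambda>p. c + L p) has_derivative L) (at p)" for p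
    using bounded_linear_imp_has_derivative[OF assms] by (auto intro!: derivative_eq_intros)
  then have "(\<lambda>p. c + L p) differentiable_on UNIV"
    by (auto simp: differentiable_on_def differentiable_def)
  moreover have "frechet_derivative (\<lambda>p. c + L p) (at p) = L" for p
    using frechet_derivative_at[OF d] by simp
  ultimately show "C_diff k (\<lambda>p. c + L p)"
    by (cases k) (auto simp: C_diff_const differentiable_imp_continuous_on)
qed

text \<open>The bilinear part of the group law in the chart: beyond the sum of the coordinates, the
  corner entry of a matrix product picks up \<open>x1 * y1' + x2 * y2'\<close>.\<close>

definition twist :: "coords \<Rightarrow> coords \<Rightarrow> coords" where
  "twist p v = (0, 0, 0, 0, fst p * fst (snd (snd v)) + fst (snd p) * fst (snd (snd (snd v))))"

interpretation twist: bounded_bilinear twist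
  unfolding bilinear_conv_bounded_bilinear[symmetric]
  by (auto simp: bilinear_def twist_def algebra_simps intro!: linearI)

text \<open>Values of \<open>twist\<close> have only the central coordinate \<open>z\<close>, which
  \<open>twist\<close> does not read: the group is two-step nilpotent. Hence
  \<open>v + twist p v\<close> is inverted by \<open>v - twist p v\<close>.\<close>

lemma twist_twist [simp]: "twist (twist p q) r = 0" "twist p (twist q r) = 0"
  by (simp_all add: twist_def zero_prod_def)

lemma vector_4_nth:
  "(vector [x,y,z,w] :: 'a::zero^4)$1 = x" "(vector [x,y,z,w] :: 'a^4)$2 = y"
  "(vector [x,y,z,w] :: 'a^4)$3 = z" "(vector [x,y,z,w] :: 'a^4)$4 = w"
  unfolding vector_def by simp_all

lemma heis_mat_mult: "heis_mat p ** heis_mat q = heis_mat (p + q + twist p q)"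
  by (cases p; cases q)
    (simp add: vec_eq_iff forall_4 matrix_matrix_mult_def sum_4 vector_4_nth twist_def)

lemma heis_mat_0: "heis_mat 0 = mat 1"
  by (simp add: zero_prod_def vec_eq_iff forall_4 vector_4_nth mat_def)

lemma heis_coords_heis_mat [simp]: "heis_coords (heis_mat p) = p"
  by (cases p) (simp add: heis_coords_def vector_4_nth)

lemma left_trans_heis_mat: "left_trans (heis_mat p) q = p + q + twist p q"
  by (simp add: left_trans_def heis_mat_mult)

lemma left_trans_has_derivative:
  "(left_trans (heis_mat p) has_derivative (\<lambda>v. v + twist p v)) (at q)"
  unfolding left_trans_heis_mat[abs_def]
  by (auto intro!: derivative_eq_intros twist.FDERIV simp: twist.zero_left)

lemma group_Heis: "group Heis"
proof (rule groupI)
  fix x assume "x \<in> carrier Heis"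
  then obtain p where p: "x = heis_mat p" by (auto simp: Heis_def)
  \<comment> \<open>The summand \<open>twist p p\<close> compensates the \<open>- twist p p\<close>
    contributed by \<open>twist (- p) p\<close>.\<close>
  have "heis_mat (- p + twist p p) ** heis_mat p = mat 1"
    by (simp add: heis_mat_mult twist.diff_left twist.minus_left heis_mat_0)
  then show "\<exists>y\<in>carrier Heis. y \<otimes>\<^bsub>Heis\<^esub> x = \<one>\<^bsub>Heis\<^esub>"
    unfolding p Heis_def by (metis (no_types) monoid.simps partial_object.simps(1) rangeI)
qed (auto simp: Heis_def heis_mat_mult matrix_mul_assoc twist.zero_left simp del: heis_mat.simps
    simp flip: heis_mat_0)

lemma Heis_int_iff:
  "heis_mat (x1, x2, y1, y2, z) \<in> Heis_int \<longleftrightarrow> x1 \<in> \<int> \<and> x2 \<in> \<int> \<and> y1 \<in> \<int> \<and> y2 \<in> \<int> \<and> z \<in> \<int>"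
  unfolding Heis_int_def by (auto simp: forall_4 vector_4_nth Heis_def simp del: heis_mat.simps)
     (auto simp: vector_4_nth)

lemma subgroup_Heis_int: "subgroup Heis_int Heis"
proof -
  interpret group Heis by (rule group_Heis)
  show ?thesis
  proof (rule subgroupI)
    show "Heis_int \<subseteq> carrier Heis" by (auto simp: Heis_int_def)
    have "heis_mat (0,0,0,0,0) \<in> Heis_int" unfolding Heis_int_iff by simp
    then show "Heis_int \<noteq> {}" by blast
    fix M assume M: "M \<in> Heis_int"
    then obtain p where p: "M = heis_mat p" by (auto simp: Heis_def Heis_int_def)
    obtain x1 x2 y1 y2 z where p': "p = (x1, x2, y1, y2, z)" by (cases p)
    have i: "x1 \<in> \<int>" "x2 \<in> \<int>" "y1 \<in> \<int>" "y2 \<in> \<int>" "z \<in> \<int>"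
      using M unfolding p p' Heis_int_iff by auto
    have *: "heis_mat (- p + twist p p) ** heis_mat p = mat 1"
      by (simp add: heis_mat_mult twist.diff_left twist.minus_left heis_mat_0)
    have "inv\<^bsub>Heis\<^esub> M = heis_mat (- p + twist p p)"
      by (rule inv_equality) (use * in \<open>auto simp: p Heis_def\<close>)
    also have "\<dots> \<in> Heis_int"
      using i by (simp add: Heis_int_iff p' twist_def del: heis_mat.simps)
    finally show "inv\<^bsub>Heis\<^esub> M \<in> Heis_int" .
    fix N assume N: "N \<in> Heis_int"
    then obtain q where q: "N = heis_mat q" by (auto simp: Heis_def Heis_int_def)
    obtain u1 u2 v1 v2 w where q': "q = (u1, u2, v1, v2, w)" by (cases q)
    have j: "u1 \<in> \<int>" "u2 \<in> \<int>" "v1 \<in> \<int>" "v2 \<in> \<int>" "w \<in> \<int>"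
      using N unfolding q q' Heis_int_iff by auto
    have "M \<otimes>\<^bsub>Heis\<^esub> N = heis_mat (p + q + twist p q)"
      by (simp add: Heis_def p q heis_mat_mult)
    also have "\<dots> \<in> Heis_int"
      using i j by (simp add: Heis_int_iff p' q' twist_def del: heis_mat.simps)
    finally show "M \<otimes>\<^bsub>Heis\<^esub> N \<in> Heis_int" .
  qed
qed

section \<open>The quotient topology and its compactness\<close>

lemma proj_mat_in_N21: "M \<in> carrier Heis \<Longrightarrow> proj_mat M \<in> N21"
  by (auto simp: N21_def proj_mat_def RCOSETS_def)

lemma proj_in_N21: "proj p \<in> N21"
  unfolding proj_def by (rule proj_mat_in_N21) (simp add: Heis_def)

text \<open>Preimages commute with intersections and unions, so the defining predicate is a topology
  and can be read back from \<open>topology\<close>.\<close>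

lemma openin_N21:
  "openin N21_topology U \<longleftrightarrow>
     U \<subseteq> N21 \<and> openin (top_of_set (carrier Heis)) {M \<in> carrier Heis. proj_mat M \<in> U}"
proof -
  let ?P = "\<lambda>U. {M \<in> carrier Heis. proj_mat M \<in> U}"
  have "?P (S \<inter> T) = ?P S \<inter> ?P T" "?P (\<Union>\<K>) = (\<Union>K\<in>\<K>. ?P K)" for S T \<K> by auto
  then have "istopology (\<lambda>U. U \<subseteq> N21 \<and> openin (top_of_set (carrier Heis)) (?P U))"
    unfolding istopology_def by (auto intro: openin_Int intro!: openin_Union)
  then show ?thesis
    unfolding N21_topology_def by (simp add: topology_inverse')
qed

lemma topspace_N21: "topspace N21_topology = N21"
proof -
  have "{M \<in> carrier Heis. proj_mat M \<in> N21} = carrier Heis"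
    using proj_mat_in_N21 by auto
  then have "openin N21_topology N21"
    unfolding openin_N21 by simp
  then show ?thesis
    using openin_N21 openin_subset[of N21_topology] by (auto simp: topspace_def)
qed

lemma continuous_heis_mat: "continuous_on UNIV heis_mat"
proof -
  have "linear (\<lambda>p. heis_mat p - mat 1)"
    by (rule linearI)
      (auto simp: vec_eq_iff forall_4 vector_4_nth mat_def)
  then have "continuous_on UNIV (\<lambda>p. (heis_mat p - mat 1) + mat 1)"
    by (intro continuous_intros linear_continuous_on) (simp add: linear_conv_bounded_linear)
  then show ?thesis by simp
qed

lemma proj_mat_left_mult:
  assumes "M \<in> Heis_int" "N \<in> carrier Heis"
  shows "proj_mat (M ** N) = proj_mat N"
proof -
  interpret group Heis by (rule group_Heis)
  have M: "M \<in> carrier Heis" using assms by (simp add: Heis_int_def)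
  have "proj_mat (M ** N) = (Heis_int #>\<^bsub>Heis\<^esub> M) #>\<^bsub>Heis\<^esub> N"
    unfolding proj_mat_def using coset_mult_assoc[of Heis_int M N] M assms subgroup.subset[OF subgroup_Heis_int]
    by (simp add: Heis_def)
  also have "Heis_int #>\<^bsub>Heis\<^esub> M = Heis_int"
    using M assms subgroup_Heis_int by (simp add: coset_join2)
  finally show ?thesis by (simp add: proj_mat_def)
qed

text \<open>Left multiplication by a suitable integer matrix reduces every coordinate to a
  fractional part, so the unit cube meets every coset.\<close>

lemma proj_mat_unit_cube:
  "proj_mat ` heis_mat ` ({0..1} \<times> {0..1} \<times> {0..1} \<times> {0..1} \<times> {0..1}) = N21" (is "?L = _")
proof
  show "?L \<subseteq> N21" by (auto intro!: proj_mat_in_N21 simp: Heis_def simp del: heis_mat.simps)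
  show "N21 \<subseteq> ?L"
  proof
    fix C assume "C \<in> N21"
    then obtain p where p: "C = proj_mat (heis_mat p)"
      by (auto simp: N21_def RCOSETS_def proj_mat_def Heis_def simp del: heis_mat.simps)
    obtain x1 x2 y1 y2 z where p': "p = (x1, x2, y1, y2, z)" by (cases p)
    \<comment> \<open>Reducing \<open>x1\<close> and \<open>x2\<close> also shifts \<open>z\<close>
      by multiples of \<open>y1\<close> and \<open>y2\<close>; \<open>w\<close> is the shifted
      value, whose floor is the one to remove.\<close>
    define w where "w = z - of_int \<lfloor>x1\<rfloor> * y1 - of_int \<lfloor>x2\<rfloor> * y2"
    define n :: coords where
      "n = (- of_int \<lfloor>x1\<rfloor>, - of_int \<lfloor>x2\<rfloor>, - of_int \<lfloor>y1\<rfloor>, - of_int \<lfloor>y2\<rfloor>, - of_int \<lfloor>w\<rfloor>)"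
    have "heis_mat n \<in> Heis_int"
      by (simp add: n_def Heis_int_iff del: heis_mat.simps)
    then have "C = proj_mat (heis_mat n ** heis_mat p)"
      unfolding p by (intro proj_mat_left_mult[symmetric]) (auto simp: Heis_def)
    then have C: "C = proj_mat (heis_mat (n + p + twist n p))"
      by (simp add: heis_mat_mult)
    have "n + p + twist n p = (frac x1, frac x2, frac y1, frac y2, frac w)"
      by (simp add: p' n_def twist_def frac_def w_def)
    then have "n + p + twist n p \<in> {0..1} \<times> {0..1} \<times> {0..1} \<times> {0..1} \<times> {0..1}"
      by (simp add: less_imp_le[OF frac_lt_1])
    then show "C \<in> ?L" unfolding C by (intro imageI)
  qed
qed

text \<open>The projection is continuous by the choice of topology and maps the compact unit cube
  onto the quotient.\<close>

lemma compact_N21: "compact_space N21_topology"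
proof -
  let ?Q = "{0..1} \<times> {0..1} \<times> {0..1} \<times> {0..1} \<times> {0..1} :: coords set"
  have c: "continuous_map (top_of_set (carrier Heis)) N21_topology proj_mat"
    unfolding continuous_map_def topspace_N21 openin_N21
    using proj_mat_in_N21 by auto
  have "compact (heis_mat ` ?Q)"
    by (intro compact_continuous_image compact_Times compact_Icc
      continuous_on_subset[OF continuous_heis_mat] subset_UNIV)
  then have "compactin (top_of_set (carrier Heis)) (heis_mat ` ?Q)"
    by (auto simp: compactin_subtopology Heis_def)
  from image_compactin[OF this c] show ?thesis
    unfolding compact_space_def topspace_N21 proj_mat_unit_cube .
qed

section \<open>Left-invariant frames\<close>

lemma e2_eq: "e2 e i j p [u,v] = e i p [u] * e j p [v] - e i p [v] * e j p [u]"
  by (simp add: e2_def wedge_1_1)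

lemma ext_d_2:
  "ext_d w p [u,v] = frechet_derivative (\<lambda>q. w q [v]) (at p) u - frechet_derivative (\<lambda>q. w q [u]) (at p) v"
  by (simp add: ext_d_def numeral_eq_Suc lessThan_Suc)

lemma ext_d_4:
  "ext_d w p [x,y,z,v] =
     frechet_derivative (\<lambda>q. w q [y,z,v]) (at p) x - frechet_derivative (\<lambda>q. w q [x,z,v]) (at p) y
   + frechet_derivative (\<lambda>q. w q [x,y,v]) (at p) z - frechet_derivative (\<lambda>q. w q [x,y,z]) (at p) v"
  by (simp add: ext_d_def numeral_eq_Suc lessThan_Suc)

text \<open>Translation by \<open>p\<close> is applied at the origin, where its derivative is
  \<open>v + twist p v\<close>; an invariant form is thus determined by its value at the
  origin.\<close>

lemma left_invariant_pullback_origin: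
  assumes "left_invariant w"
  shows "w p (map (\<lambda>v. v + twist p v) vs) = w 0 vs"
proof -
  have d: "frechet_derivative (left_trans (heis_mat p)) (at 0) = (\<lambda>v. v + twist p v)"
    using frechet_derivative_at[OF left_trans_has_derivative] by simp
  have "heis_mat p \<in> carrier Heis" by (simp add: Heis_def)
  with assms have "w (left_trans (heis_mat p) 0)
      (map (frechet_derivative (left_trans (heis_mat p)) (at 0)) vs) = w 0 vs"
    unfolding left_invariant_def by blast
  then show ?thesis
    by (simp add: d left_trans_heis_mat twist.zero_right)
qed

locale N21_frame =
  fixes a b c :: real and e :: "nat \<Rightarrow> coords form"
  assumes coframe: "N21_coframe a b c e"
begin

abbreviation E :: "nat \<Rightarrow> coords vfield" where "E \<equiv> dual_frame e"

lemma one_form_e: "k \<in> {1..5} \<Longrightarrow> one_form (e k)"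
  and left_invariant_e: "k \<in> {1..5} \<Longrightarrow> left_invariant (e k)"
  using coframe by (auto simp: N21_coframe_def left_invariant_basis_def)

lemma e_length: "k \<in> {1..5} \<Longrightarrow> length vs \<noteq> 1 \<Longrightarrow> e k p vs = 0"
  using one_form_e[of k] unfolding one_form_def by blast

lemma linear_e: "k \<in> {1..5} \<Longrightarrow> linear (\<lambda>v. e k p [v])"
  using one_form_e[of k] unfolding one_form_def by blast

lemmas e_add = linear_add[OF linear_e]
  and e_diff = linear_diff[OF linear_e]
  and e_scale = linear_scale[OF linear_e]
  and e_sum = linear_sum[OF linear_e]

lemma e_translate:
  assumes "k \<in> {1..5}"
  shows "e k p [v] = e k 0 [v - twist p v]"
  using left_invariant_pullback_origin[OF left_invariant_e[OF assms], of p "[v - twist p v]"]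
  by (simp add: twist.diff_right)

lemma e_twist:
  assumes "k \<in> {1..5}"
  shows "e k p [twist u v] = e k 0 [twist u v]"
  using e_translate[OF assms, of p "twist u v"] by simp

text \<open>A vector orthogonal to a proper range would be a linear relation between the
  \<open>e i\<close> at the origin; invariance spreads it to all points, against the independence of
  the basis.\<close>

lemma surj_coframe:
  "surj (\<lambda>v. (e 1 0 [v], e 2 0 [v], e 3 0 [v], e 4 0 [v], e 5 0 [v]))" (is "surj ?L")
proof (rule ccontr)
  assume "\<not> surj ?L"
  have "linear ?L"
    by (rule linearI) (simp_all add: e_add e_scale)
  define S where "S = range ?L"
  have "span S = S"
    using \<open>linear ?L\<close> by (simp add: S_def linear_subspace_image span_eq_iff)
  moreover have "S \<noteq> UNIV"
    using \<open>\<not> surj ?L\<close> by (simp add: S_def)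
  ultimately have "dim S \<noteq> DIM(coords)"
    unfolding dim_eq_full by metis
  then have "dim S < DIM(coords)"
    using dim_subset_UNIV[of S] by (rule le_neq_implies_less[rotated])
  then obtain x where x: "x \<noteq> 0" "\<And>y. y \<in> span S \<Longrightarrow> orthogonal x y"
    by (rule orthogonal_to_subspace_exists) blast
  obtain x1 x2 x3 x4 x5 where x': "x = (x1, x2, x3, x4, x5)" by (cases x)
  define c :: "nat \<Rightarrow> real" where "c = (\<lambda>i. if i = 1 then x1 else if i = 2 then x2 else
    if i = 3 then x3 else if i = 4 then x4 else x5)"
  have 0: "(\<Sum>i=1..5. c i * e i 0 [v]) = 0" for v
    using x(2)[of "?L v"] unfolding orthogonal_def x'
    by (simp add: sum_1_to_5 c_def span_base S_def)
  have "(\<Sum>i=1..5. c i * e i p vs) = 0" for p vs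
  proof (cases "length vs = 1")
    case True
    then obtain v where "vs = [v]" by (auto simp: length_Suc_conv One_nat_def)
    then show ?thesis using 0[of "v - twist p v"] by (simp add: e_translate[of _ p v])
  qed (simp add: e_length)
  then have "\<forall>i\<in>{1..5}. c i = 0"
    using coframe unfolding N21_coframe_def left_invariant_basis_def by blast
  then show False
    using x(1) unfolding x' ball_1_to_5 by (simp add: c_def zero_prod_def)
qed

text \<open>At the origin a surjective linear map between spaces of equal dimension is injective;
  \<open>e_translate\<close> moves this to \<open>p\<close>.\<close>

lemma e_eqI:
  assumes "\<And>k. k \<in> {1..5} \<Longrightarrow> e k p [u] = e k p [v]"
  shows "u = v"
proof -
  let ?L = "\<lambda>v. (e 1 0 [v], e 2 0 [v], e 3 0 [v], e 4 0 [v], e 5 0 [v])"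
  have "linear ?L"
    by (rule linearI) (simp_all add: e_add e_scale)
  then have "inj ?L"
    using linear_surjective_imp_injective surj_coframe by blast
  moreover have "?L (u - twist p u) = ?L (v - twist p v)"
    using assms by (simp flip: e_translate)
  ultimately have *: "u - twist p u = v - twist p v" by (rule injD)
  \<comment> \<open>A second \<open>twist p\<close> kills the inner one, which isolates
    \<open>twist p u = twist p v\<close>.\<close>
  then have "twist p (u - twist p u) = twist p (v - twist p v)" by (rule arg_cong)
  then have "twist p u = twist p v" by (simp add: twist.diff_right)
  then show ?thesis using * by simp
qed

lemma e_dual:
  assumes "j \<in> {1..5}" "k \<in> {1..5}"
  shows "e k p [E j p] = (if k = j then 1 else 0)"
proof -
  let ?d = "\<lambda>k. if k = j then 1 else 0 :: real"
  let ?P = "\<lambda>v. \<forall>k\<in>{1..5}. e k p [v] = ?d k"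
  \<comment> \<open>The frame vector at the origin; its translate to \<open>p\<close> is the witness
    for the description operator in \<open>dual_frame\<close>.\<close>
  obtain f where "(?d 1, ?d 2, ?d 3, ?d 4, ?d 5) =
      (e 1 0 [f], e 2 0 [f], e 3 0 [f], e 4 0 [f], e 5 0 [f])"
    using surj_coframe unfolding surj_def by blast
  then have "\<forall>k\<in>{1..5}. e k 0 [f] = ?d k"
    unfolding ball_1_to_5 by (simp del: if_split)
  then have f: "?P (f + twist p f)"
    by (simp add: e_translate[of _ p] twist.add_right)
  have "?P (THE v. ?P v)"
  proof (rule theI[of ?P])
    show "?P (f + twist p f)" by (rule f)
    fix v assume "?P v"
    then show "v = f + twist p f" using f by (intro e_eqI[of p]) metis
  qed
  then show ?thesis using assms unfolding dual_frame_def by blast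
qed

lemma frame_expansion: "v = (\<Sum>k=1..5. e k p [v] *\<^sub>R E k p)"
proof (rule e_eqI[of p])
  fix k :: nat assume k: "k \<in> {1..5}"
  have "e k p [\<Sum>l=1..5. e l p [v] *\<^sub>R E l p] = (\<Sum>l=1..5. e l p [v] * (if k = l then 1 else 0))"
    using k by (simp add: e_sum e_scale e_dual)
  also have "\<dots> = e k p [v]"
    using k by (simp add: if_distrib sum.delta cong: if_cong)
  finally show "e k p [v] = e k p [\<Sum>l=1..5. e l p [v] *\<^sub>R E l p]" by simp
qed

lemma frame_affine: "j \<in> {1..5} \<Longrightarrow> E j p = E j 0 + twist p (E j 0)"
  by (rule e_eqI[of p]) (simp add: e_dual e_translate[of _ p "E j 0 + twist p (E j 0)"] twist.add_right)

lemma twist_frame: "j \<in> {1..5} \<Longrightarrow> twist h (E j p) = twist h (E j 0)"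
  by (subst frame_affine) (simp_all add: twist.add_right)

lemma smooth_frame: "j \<in> {1..5} \<Longrightarrow> smooth (E j)"
  using smooth_affine[OF twist.bounded_linear_left, of "E j 0" "E j 0"] frame_affine
  by (metis (no_types, lifting) ext)

lemma frechet_derivative_frame:
  assumes "j \<in> {1..5}"
  shows "frechet_derivative (E j) (at p) h = twist h (E j p)"
proof -
  have "E j = (\<lambda>p. E j 0 + twist p (E j 0))"
    using frame_affine[OF assms] by (rule ext)
  moreover have "((\<lambda>p. E j 0 + twist p (E j 0)) has_derivative (\<lambda>h. twist h (E j 0))) (at p)"
    by (auto intro!: derivative_eq_intros
        bounded_linear_imp_has_derivative twist.bounded_linear_left)
  ultimately show ?thesis
    using frechet_derivative_at[of "E j"] twist_frame[OF assms] by metis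
qed

lemma e_has_derivative:
  assumes "k \<in> {1..5}"
  shows "((\<lambda>p. e k p [v]) has_derivative (\<lambda>h. - e k 0 [twist h v])) (at p)"
proof -
  have "bounded_linear (\<lambda>h. e k 0 [twist h v])"
    using linear_compose[OF _ linear_e[OF assms], of "\<lambda>h. twist h v" 0] 
      bounded_linear.linear[OF twist.bounded_linear_left]
    by (simp add: linear_conv_bounded_linear o_def)
  moreover have "(\<lambda>p. e k p [v]) = (\<lambda>p. e k 0 [v] - e k 0 [twist p v])"
    by (rule ext) (subst e_translate[OF assms], rule e_diff[OF assms])
  ultimately show ?thesis
    by (auto intro!: derivative_eq_intros bounded_linear_imp_has_derivative)
qed

lemma frechet_derivative_e:
  "k \<in> {1..5} \<Longrightarrow> frechet_derivative (\<lambda>p. e k p [v]) (at p) h = - e k 0 [twist h v]"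
  using frechet_derivative_at[OF e_has_derivative] by metis

lemma ext_d_e:
  "k \<in> {1..5} \<Longrightarrow> ext_d (e k) p [u,v] = e k 0 [twist v u] - e k 0 [twist u v]"
  by (simp add: ext_d_2 frechet_derivative_e)

lemma ext_d_e_closed: "k \<in> {1..5} \<Longrightarrow> k \<noteq> 5 \<Longrightarrow> ext_d (e k) p vs = 0"
  using coframe by (auto simp: N21_coframe_def)

text \<open>The form \<open>de\<^sup>5\<close>, which is constant in the chart.\<close>

definition omega :: "coords \<Rightarrow> coords \<Rightarrow> real" where
  "omega u v = e 5 0 [twist v u] - e 5 0 [twist u v]"

lemma ext_d_e5: "ext_d (e 5) p [u,v] = omega u v"
  by (simp add: ext_d_e omega_def)

lemma ext_d_e_eq: "k \<in> {1..5} \<Longrightarrow> ext_d (e k) p [u,v] = (if k = 5 then omega u v else 0)"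
  by (simp add: ext_d_e5 ext_d_e_closed)

lemma omega_eq:
  "omega u v = a * (e2 e 1 2 p [u,v] - e2 e 3 4 p [u,v]) +
        b * (e2 e 1 3 p [u,v] + e2 e 2 4 p [u,v]) + c * (e2 e 1 4 p [u,v] - e2 e 2 3 p [u,v])"
  using coframe ext_d_e5 unfolding N21_coframe_def by metis

lemma omega_swap: "omega v u = - omega u v"
  by (simp add: omega_def)

text \<open>The left side is the \<open>k\<close>-component of the bracket of two frame fields, so
  this is \<open>de^k(X, Y) = - e^k([X, Y])\<close> for invariant fields.\<close>

lemma omega_bracket:
  "k \<in> {1..5} \<Longrightarrow> e k p [twist u v] - e k p [twist v u] = - (if k = 5 then omega u v else 0)"
  using ext_d_e ext_d_e_eq e_twist by (smt (verit))

lemma linear_omega: "linear (\<lambda>u. omega u v)"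
  and linear_omega_right: "linear (\<lambda>v. omega u v)"
  by (rule linearI;
    simp add: omega_def twist.add_left twist.add_right e_add twist.scaleR_left twist.scaleR_right
      e_scale algebra_simps)+

lemma omega_expansion: "omega v w = (\<Sum>k=1..5. e k p [v] * omega (E k p) w)"
proof -
  have "omega v w = omega (\<Sum>k=1..5. e k p [v] *\<^sub>R E k p) w"
    using frame_expansion[of v p] by simp
  then show ?thesis by (simp add: linear_sum[OF linear_omega] linear_scale[OF linear_omega])
qed

text \<open>The matrix of \<open>de^5\<close> has the same anti-self-dual pattern as the instanton;
  the arguments are negated because \<open>instanton_coeff\<close> carries minus signs.\<close>

definition Om :: "nat \<Rightarrow> nat \<Rightarrow> real" where
  "Om = instanton_coeff (- a) (- b) (- c)"

lemma omega_frame: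
  assumes "i \<in> {1..5}" "j \<in> {1..5}"
  shows "omega (E i p) (E j p) = Om i j"
proof -
  have "\<forall>i\<in>{1..5}. \<forall>j\<in>{1..5}. omega (E i p) (E j p) = Om i j"
    unfolding ball_1_to_5 omega_eq[of _ _ p] e2_eq by (simp add: e_dual Om_def instanton_coeff_def)
  then show ?thesis using assms by blast
qed

section \<open>The Levi-Civita connection\<close>

lemma metric_sym: "coframe_metric e p u v = coframe_metric e p v u"
  by (simp add: coframe_metric_def mult.commute)

lemma metric_frame: "k \<in> {1..5} \<Longrightarrow> coframe_metric e p u (E k p) = e k p [u]"
  by (simp add: coframe_metric_def e_dual if_distrib sum.delta cong: if_cong)

text \<open>Metric compatibility and vanishing torsion determine the connection on frame fields; a
  second use of both passes to a constant direction \<open>v\<close>, as \<open>conn_form\<close>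
  requires.\<close>

lemma levi_civita_form:
  assumes LC: "levi_civita (coframe_metric e) N" and j: "j \<in> {1..5}" and k: "k \<in> {1..5}"
  shows "e k p [N (\<lambda>_. v) (E j) p] = 1/2 * (e 5 p [v] * Om j k
    - (if k = 5 then omega v (E j p) else 0) + (if j = 5 then omega v (E k p) else 0))"
proof -
  let ?g = "coframe_metric e"
  have compat: "frechet_derivative (\<lambda>q. ?g q (Y q) (Z q)) (at p) (X p) =
      ?g p (N X Y p) (Z p) + ?g p (Y p) (N X Z p)"
    if "smooth X" "smooth Y" "smooth Z" for X Y Z
    using LC that unfolding levi_civita_def by blast
  have torsion: "N X Y p - N Y X p = lie_bracket X Y p" if "smooth X" "smooth Y" for X Y
    using LC that unfolding levi_civita_def by blast
  define w where "w i j k = e k p [N (E i) (E j) p]" for i j k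
  have w_skew: "w i j k + w i k j = 0" if "i \<in> {1..5}" "j \<in> {1..5}" "k \<in> {1..5}" for i j k
    using compat[of "E i" "E j" "E k"] that
    by (simp add: smooth_frame metric_frame e_dual w_def metric_sym[of p "E j p"])
  have w_torsion: "w i j k - w j i k = - (if k = 5 then Om i j else 0)"
    if "i \<in> {1..5}" "j \<in> {1..5}" "k \<in> {1..5}" for i j k
  proof -
    have "w i j k - w j i k = e k p [lie_bracket (E i) (E j) p]"
      using torsion[of "E i" "E j"] that by (simp add: smooth_frame w_def flip: e_diff)
    also have "\<dots> = e k p [twist (E i p) (E j p)] - e k p [twist (E j p) (E i p)]"
      using that by (simp add: lie_bracket_def frechet_derivative_frame e_diff)
    finally show ?thesis
      using that by (simp add: omega_bracket omega_frame)
  qed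
  \<comment> \<open>Koszul's argument: skewness and torsion for the three cyclic rotations of
    \<open>j\<close>, \<open>k\<close>, \<open>l\<close> form a linear system that determines
    \<open>w j k l\<close>.\<close>
  have w: "w j k l = 1/2 * (- (if l = 5 then Om j k else 0) + (if j = 5 then Om k l else 0)
      - (if k = 5 then Om l j else 0))" if "l \<in> {1..5}" for l
    using w_skew[OF j k that] w_skew[OF k that j] w_skew[OF that j k]
      w_torsion[OF j k that] w_torsion[OF k that j] w_torsion[OF that j k] by argo
  \<comment> \<open>Compatibility along \<open>E j\<close>, applied to the constant field
    \<open>v\<close> and to \<open>E k\<close>, gives the derivative of \<open>v\<close> along
    \<open>E j\<close>; torsion-freeness then exchanges the two slots.\<close>
  have "frechet_derivative (\<lambda>q. e k q [v]) (at p) (E j p) =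
      e k p [N (E j) (\<lambda>_. v) p] + coframe_metric e p v (N (E j) (E k) p)"
    using compat[of "E j" "\<lambda>_. v" "E k"] j k by (simp add: smooth_frame smooth_const metric_frame)
  moreover have "coframe_metric e p v (N (E j) (E k) p) = (\<Sum>l=1..5. e l p [v] * w j k l)"
    by (simp add: coframe_metric_def w_def)
  moreover have "N (\<lambda>_. v) (E j) p = N (E j) (\<lambda>_. v) p + twist v (E j p)"
    using torsion[of "\<lambda>_. v" "E j"] j
    by (simp add: smooth_frame smooth_const lie_bracket_def frechet_derivative_frame algebra_simps)
  ultimately have "e k p [N (\<lambda>_. v) (E j) p] =
      e k p [twist v (E j p)] - e k p [twist (E j p) v] - (\<Sum>l=1..5. e l p [v] * w j k l)"
    using k by (simp add: frechet_derivative_e e_add e_twist[of k p])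
  also have "(\<Sum>l=1..5. e l p [v] * w j k l) = (\<Sum>l=1..5. 1/2 * (- (if l = 5 then e l p [v] * Om j k else 0)
      + (if j = 5 then e l p [v] * omega (E k p) (E l p) else 0)
      - (if k = 5 then e l p [v] * omega (E l p) (E j p) else 0)))"
    using j k by (intro sum.cong refl) (simp add: w omega_frame right_diff_distrib distrib_left)
  also have "\<dots> = 1/2 * (- (e 5 p [v] * Om j k) - (if j = 5 then omega v (E k p) else 0)
      - (if k = 5 then omega v (E j p) else 0))"
    unfolding omega_expansion[of v _ p] omega_swap[of "E k p"]
    by (simp add: sum_1_to_5 algebra_simps)
  finally show ?thesis
    unfolding omega_bracket[OF k] by (auto simp: field_simps)
qed

section \<open>Connection and curvature forms\<close>

lemma conn_form_length: "length vs \<noteq> 1 \<Longrightarrow> conn_form e N i j p vs = 0"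
  by (simp add: conn_form_def)

text \<open>Expanding \<open>omega v\<close> in the coframe brings the forms into the shape that
  \<open>curv_form_constant_coefficients\<close> asks for.\<close>

lemma conn_form_levi_civita:
  assumes "levi_civita (coframe_metric e) N" "i \<in> {1..5}" "j \<in> {1..5}"
  shows "conn_form e N i j p vs = (\<Sum>l=1..5. 1/2 * ((if l = 5 then Om j i else 0)
    - (if i = 5 then Om l j else 0) + (if j = 5 then Om l i else 0)) * e l p vs)"
proof (cases "length vs = 1")
  case True
  then obtain v where v: "vs = [v]" by (auto simp: length_Suc_conv One_nat_def)
  have "conn_form e N i j p [v] = 1/2 * (e 5 p [v] * Om j i
    - (if i = 5 then omega v (E j p) else 0) + (if j = 5 then omega v (E i p) else 0))"
    using levi_civita_form[OF assms(1) assms(3) assms(2), of p v] by (simp add: conn_form_def)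
  also have "\<dots> = (\<Sum>l=1..5. 1/2 * ((if l = 5 then Om j i else 0)
    - (if i = 5 then Om l j else 0) + (if j = 5 then Om l i else 0)) * e l p [v])"
    unfolding omega_expansion[of v _ p] using assms(2,3)
    by (simp add: sum_1_to_5 omega_frame algebra_simps)
  finally show ?thesis by (simp add: v)
qed (simp add: conn_form_length e_length)

text \<open>Since \<open>e 1\<close> to \<open>e 4\<close> are closed, only the \<open>e 5\<close>
  coefficient contributes to the exterior derivative.\<close>

lemma curv_form_constant_coefficients:
  assumes S: "\<And>i j p vs. i \<in> {1..5} \<Longrightarrow> j \<in> {1..5} \<Longrightarrow>
      conn_form e N i j p vs = (\<Sum>l=1..5. S i j l * e l p vs)"
    and ij: "i \<in> {1..5}" "j \<in> {1..5}"
  shows "curv_form e N i j p [u,v] = S i j 5 * omega u v +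
    (\<Sum>k=1..5. (\<Sum>l=1..5. S i k l * e l p [u]) * (\<Sum>l=1..5. S k j l * e l p [v])
      - (\<Sum>l=1..5. S i k l * e l p [v]) * (\<Sum>l=1..5. S k j l * e l p [u]))"
proof -
  have "((\<lambda>q. \<Sum>l=1..5. S i j l * e l q [v]) has_derivative
      (\<lambda>h. \<Sum>l=1..5. S i j l * (- e l 0 [twist h v]))) (at p)" for v
    by (intro has_derivative_sum has_derivative_mult_right e_has_derivative) simp
  then have d: "frechet_derivative (\<lambda>q. \<Sum>l=1..5. S i j l * e l q [v]) (at p) =
      (\<lambda>h. \<Sum>l=1..5. S i j l * (- e l 0 [twist h v]))" for v
    by (rule frechet_derivative_at[symmetric])
  have "ext_d (conn_form e N i j) p [u,v] = (\<Sum>l=1..5. S i j l * ext_d (e l) p [u,v])"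
    unfolding ext_d_2[of "conn_form e N i j"] S[OF ij] d
    by (simp add: ext_d_e right_diff_distrib sum_subtractf sum_negf)
  also have "\<dots> = S i j 5 * omega u v"
    by (simp add: ext_d_e_eq sum_1_to_5)
  finally show ?thesis
    using ij by (simp add: curv_form_def wedge_1_1 S)
qed

text \<open>All connection forms are multiples of \<open>e 5\<close>, so their wedge products vanish
  and only the exterior derivative is left.\<close>

lemma curv_form_instanton:
  assumes A: "instanton_connection e lam mu tau A" and ij: "i \<in> {1..5}" "j \<in> {1..5}"
  shows "curv_form e A i j p [u,v] = instanton_coeff lam mu tau i j * omega u v"
proof -
  define S where "S i j l = (if l = 5 then instanton_coeff lam mu tau i j else 0)" for i j l :: nat
  have "conn_form e A i j p vs = (\<Sum>l=1..5. S i j l * e l p vs)"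
    if "i \<in> {1..5}" "j \<in> {1..5}" for i j p vs
    using A that by (simp add: instanton_connection_def S_def sum_1_to_5)
  from curv_form_constant_coefficients[OF this ij] show ?thesis
    by (simp add: S_def sum_1_to_5)
qed

text \<open>The contraction \<open>- \<iota>\<^sub>i de\<^sup>5\<close> of \<open>de\<^sup>5\<close> with a frame vector.\<close>

definition theta :: "coords \<Rightarrow> nat \<Rightarrow> coords \<Rightarrow> real" where
  "theta p i v = (\<Sum>l=1..5. Om l i * e l p [v])"

lemma Om_5 [simp]: "Om 5 i = 0" "Om i 5 = 0"
  by (simp_all add: Om_def instanton_coeff_def)

text \<open>For \<open>i, j \<le> 4\<close> the quadratic terms with \<open>k \<le> 4\<close> are
  multiples of \<open>e^5 \<and> e^5\<close>, so only \<open>k = 5\<close> survives. In the column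
  \<open>j = 5\<close> every surviving term contains \<open>e 5\<close>; this decomposability makes
  its square vanish in \<open>p_1\<close>.\<close>

lemma
  assumes "levi_civita (coframe_metric e) N" and i: "i \<in> {1..4}"
  shows curv_form_levi_civita: "\<And>j. j \<in> {1..4} \<Longrightarrow> curv_form e N i j p [u,v] =
      1/2 * Om j i * omega u v - 1/4 * (theta p i u * theta p j v - theta p i v * theta p j u)"
    and curv_form_levi_civita_5: "\<exists>\<kappa>. \<forall>u v. curv_form e N i 5 p [u,v] =
      e 5 p [u] * \<kappa> v - e 5 p [v] * \<kappa> u"
proof -
  define S where "S i j l = 1/2 * ((if l = 5 then Om j i else 0)
    - (if i = 5 then Om l j else 0) + (if j = 5 then Om l i else 0))" for i j l
  have S1: "(\<Sum>l=1..5. S i j l * e l p [v]) = 1/2 * Om j i * e 5 p [v]"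
    if "i \<noteq> 5" "j \<noteq> 5" for i j v
    using that by (simp add: S_def sum_1_to_5)
  have S2: "(\<Sum>l=1..5. S i 5 l * e l p [v]) = 1/2 * theta p i v" if "i \<noteq> 5" for i v
    using that by (simp add: S_def sum_1_to_5 theta_def algebra_simps)
  have S3: "(\<Sum>l=1..5. S 5 j l * e l p [v]) = - 1/2 * theta p j v" if "j \<noteq> 5" for j v
    using that by (simp add: S_def sum_1_to_5 theta_def algebra_simps)
  have S4: "(\<Sum>l=1..5. S 5 5 l * e l p [v]) = 0" for v
    by (simp add: S_def sum_1_to_5)
  have S0: "S i j 5 = (if i = 5 \<or> j = 5 then 0 else 1/2 * Om j i)" for i j
    by (simp add: S_def)
  have C: "curv_form e N i j p [u,v] = S i j 5 * omega u v +
    (\<Sum>k=1..5. (\<Sum>l=1..5. S i k l * e l p [u]) * (\<Sum>l=1..5. S k j l * e l p [v])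
      - (\<Sum>l=1..5. S i k l * e l p [v]) * (\<Sum>l=1..5. S k j l * e l p [u]))"
    if "i \<in> {1..5}" "j \<in> {1..5}" for i j u v
    by (rule curv_form_constant_coefficients)
      (use conn_form_levi_civita[OF assms(1), folded S_def] that in blast)+
  have i5: "i \<in> {1..5}" "i \<noteq> 5" using i by auto
  { fix j :: nat assume "j \<in> {1..4}"
    then have j: "j \<in> {1..5}" "j \<noteq> 5" by auto
    show "curv_form e N i j p [u,v] =
      1/2 * Om j i * omega u v - 1/4 * (theta p i u * theta p j v - theta p i v * theta p j u)"
      unfolding C[OF i5(1) j(1)] sum_1_to_5[of "\<lambda>k. _ k - _ k"]
      using i5 j by (simp add: S0 S1 S2 S3 diff_divide_distrib) }
  have "curv_form e N i 5 p [u,v] = e 5 p [u] * (\<Sum>k=1..4. 1/4 * Om k i * theta p k v)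
      - e 5 p [v] * (\<Sum>k=1..4. 1/4 * Om k i * theta p k u)" for u v
  proof -
    have *: "{1..4::nat} = {1,2,3,4}" by auto
    show ?thesis
      unfolding C[OF i5(1), of 5, simplified] sum_1_to_5[of "\<lambda>k. _ k - _ k"] *
      using i5 by (simp add: S0 S1 S2 S4) (simp add: algebra_simps)
  qed
  then show "\<exists>\<kappa>. \<forall>u v. curv_form e N i 5 p [u,v] = e 5 p [u] * \<kappa> v - e 5 p [v] * \<kappa> u"
    by (intro exI[of _ "\<lambda>v. \<Sum>k=1..4. 1/4 * Om k i * theta p k v"]) blast
qed

lemma curv_form_swap: "curv_form e N i j p [v,u] = - curv_form e N i j p [u,v]"
  by (simp add: curv_form_def ext_d_2 wedge_1_1 sum_negf[symmetric] flip: sum.distrib)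

end

section \<open>Spinors\<close>

lemma scaleR_matrix_vector_mult: "(r *\<^sub>R M) *v x = r *\<^sub>R (M *v (x :: complex^'n))"
  by (simp add: vec_eq_iff matrix_vector_mult_def scaleR_sum_right)

lemma matrix_vector_mult_minus_right: "M *v (- x) = - (M *v (x :: complex^'n))"
  by (simp add: vec_eq_iff matrix_vector_mult_def sum_negf)

lemma sum_matrix_vector_mult: "(\<Sum>i\<in>A. M i) *v x = (\<Sum>i\<in>A. M i *v (x :: complex^'n))"
  by (induction A rule: infinite_finite_induct) (simp_all add: matrix_vector_mult_add_rdistrib)

section \<open>Clifford relations and chirality\<close>

locale clifford_module =
  fixes G :: "nat \<Rightarrow> complex^4^4"
  assumes gamma: "gamma_matrices G"
begin

lemma gamma_anticomm:
  assumes "m \<in> {1..5}" "n \<in> {1..5}" "m \<noteq> n"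
  shows "G n *v (G m *v x) = - (G m *v (G n *v x))"
proof -
  have "G m ** G n + G n ** G m = 0"
    using gamma assms by (simp add: gamma_matrices_def)
  then have "(G m ** G n + G n ** G m) *v x = 0 *v x" by (rule arg_cong)
  then show ?thesis
    by (simp add: matrix_vector_mult_add_rdistrib matrix_vector_mul_assoc[symmetric] eq_neg_iff_add_eq_0 add.commute)
qed

lemma gamma_square:
  assumes "m \<in> {1..5}"
  shows "G m *v (G m *v x) = x"
proof -
  have "G m ** G m + G m ** G m = mat 2"
    using gamma assms by (simp add: gamma_matrices_def)
  also have "mat 2 = mat 1 + (mat 1 :: complex^4^4)"
    by (simp add: mat_def vec_eq_iff)
  finally have "G m ** G m + G m ** G m = mat 1 + mat 1" .
  from arg_cong[OF this, of "\<lambda>M. M *v x"] have "(G m ** G m + G m ** G m) *v x = (mat 1 + mat 1) *v x" .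
  then have "(2::real) *\<^sub>R (G m *v (G m *v x)) = (2::real) *\<^sub>R x"
    by (simp only: matrix_vector_mult_add_rdistrib matrix_vector_mul_assoc[symmetric] matrix_vector_mul_lid scaleR_2)
  then show ?thesis by simp
qed

lemma gamma_asym_2:
  assumes "m \<in> {1..5}" "n \<in> {1..5}"
  shows "gamma_asym G [m,n] *v x = (if m = n then 0 else G m *v (G n *v x))"
proof -
  have l: "length [m,n] = 2" by simp
  have "gamma_asym G [m,n] = (1/2) *\<^sub>R (G m ** G n - G n ** G m)"
    unfolding gamma_asym_def l sum_permutations_2[of "\<lambda>l. foldr (\<lambda>m M. G m ** M) l (mat 1)"] by (simp add: fact_numeral)
  then have "gamma_asym G [m,n] *v x = (1/2) *\<^sub>R (G m *v (G n *v x) - G n *v (G m *v x))"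
    by (simp only: scaleR_matrix_vector_mult matrix_vector_mult_diff_rdistrib matrix_vector_mul_assoc)
  then show ?thesis
    using gamma_anticomm[OF assms] by (simp add: scaleR_2[symmetric])
qed

lemma gamma_asym_3:
  assumes "m \<in> {1..5}" "n \<in> {1..5}" "k \<in> {1..5}" "m \<noteq> n" "m \<noteq> k" "n \<noteq> k"
  shows "gamma_asym G [m,n,k] *v x = G m *v (G n *v (G k *v x))"
proof -
  have l: "length [m,n,k] = 3" by simp
  note a = gamma_anticomm[of m n] gamma_anticomm[of m k] gamma_anticomm[of n k]
  have "gamma_asym G [m,n,k] *v x = (1/6) *\<^sub>R (G m *v (G n *v (G k *v x)) - G m *v (G k *v (G n *v x))
    - G n *v (G m *v (G k *v x)) + G n *v (G k *v (G m *v x))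
    + G k *v (G m *v (G n *v x)) - G k *v (G n *v (G m *v x)))"
    unfolding gamma_asym_def l sum_permutations_3[of "\<lambda>l. foldr (\<lambda>m M. G m ** M) l (mat 1)"]
    by (simp add: fact_numeral scaleR_matrix_vector_mult matrix_vector_mult_diff_rdistrib
      matrix_vector_mult_add_rdistrib matrix_vector_mul_assoc matrix_mul_assoc)
  also have "\<dots> = (1/6) *\<^sub>R (6::real) *\<^sub>R (G m *v (G n *v (G k *v x)))"
    using assms by (simp add: a matrix_vector_mult_minus_right)
  finally show ?thesis by simp
qed

definition half_spinor :: "complex^4 \<Rightarrow> bool" where
  "half_spinor x \<longleftrightarrow> G 1 *v (G 2 *v (G 3 *v (G 4 *v x))) = - x"

text \<open>As rewrite rules these sort products into the order 5, 1, 2, 3, 4; together with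
  \<open>gamma_square_simps\<close> they give a normal form.\<close>

lemma gamma_sort:
  "G 2 *v (G 1 *v x) = - (G 1 *v (G 2 *v x))"
  "G 3 *v (G 1 *v x) = - (G 1 *v (G 3 *v x))"
  "G 4 *v (G 1 *v x) = - (G 1 *v (G 4 *v x))"
  "G 3 *v (G 2 *v x) = - (G 2 *v (G 3 *v x))"
  "G 4 *v (G 2 *v x) = - (G 2 *v (G 4 *v x))"
  "G 4 *v (G 3 *v x) = - (G 3 *v (G 4 *v x))"
  "G 1 *v (G 5 *v x) = - (G 5 *v (G 1 *v x))"
  "G 2 *v (G 5 *v x) = - (G 5 *v (G 2 *v x))"
  "G 3 *v (G 5 *v x) = - (G 5 *v (G 3 *v x))"
  "G 4 *v (G 5 *v x) = - (G 5 *v (G 4 *v x))"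
  by (rule gamma_anticomm; simp)+

lemma gamma_square_simps:
  "G 1 *v (G 1 *v x) = x" "G 2 *v (G 2 *v x) = x" "G 3 *v (G 3 *v x) = x"
  "G 4 *v (G 4 *v x) = x" "G 5 *v (G 5 *v x) = x"
  by (simp_all add: gamma_square)

text \<open>The chirality operator \<open>P\<close> is an involution anticommuting with
  \<open>G 1\<close>. If it were the identity, \<open>G 1\<close> would vanish although it squares
  to 1; so some \<open>y - P y\<close> is nonzero, and \<open>P\<close> negates it.\<close>

lemma half_spinor_exists: "\<exists>x. x \<noteq> 0 \<and> half_spinor x"
proof -
  define P where "P x = G 1 *v (G 2 *v (G 3 *v (G 4 *v x)))" for x
  have PP: "P (P x) = x" and PG: "P (G 1 *v x) = - (G 1 *v P x)" for x
    by (simp_all add: P_def gamma_sort gamma_square_simps matrix_vector_mult_minus_right)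
  have "\<exists>y. P y \<noteq> y"
  proof (rule ccontr)
    assume "\<nexists>y. P y \<noteq> y"
    then have "G 1 *v x = - (G 1 *v x)" for x using PG by metis
    then have "G 1 *v x = 0" for x by (simp add: vec_eq_iff)
    then have "(1 :: complex^4) = 0" using gamma_square_simps(1) by metis
    then show False by simp
  qed
  then obtain y where "P y \<noteq> y" by blast
  then have "y - P y \<noteq> 0" by simp
  moreover have "P (y - P y) = P y - P (P y)"
    by (simp add: P_def matrix_vector_mult_diff_distrib)
  ultimately show ?thesis
    using PP[of y] unfolding half_spinor_def P_def[symmetric] by (metis minus_diff_eq)
qed

text \<open>Replacing \<open>x\<close> on one side by minus its image under the chirality operator
  and sorting yields the other side.\<close>

lemma half_spinor_relations:
  assumes "half_spinor x"
  shows "G 3 *v (G 4 *v x) = G 1 *v (G 2 *v x)"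
    "G 2 *v (G 4 *v x) = - (G 1 *v (G 3 *v x))"
    "G 2 *v (G 3 *v x) = G 1 *v (G 4 *v x)"
proof -
  have x: "x = - (G 1 *v (G 2 *v (G 3 *v (G 4 *v x))))"
    using assms by (simp add: half_spinor_def)
  show "G 3 *v (G 4 *v x) = G 1 *v (G 2 *v x)"
    by (subst (2) x) (simp add: gamma_sort gamma_square_simps matrix_vector_mult_minus_right)
  show "G 2 *v (G 4 *v x) = - (G 1 *v (G 3 *v x))"
    by (subst (2) x) (simp add: gamma_sort gamma_square_simps matrix_vector_mult_minus_right)
  show "G 2 *v (G 3 *v x) = G 1 *v (G 4 *v x)"
    by (subst (2) x) (simp add: gamma_sort gamma_square_simps matrix_vector_mult_minus_right)
qed

text \<open>Anti-self-dual two-forms annihilate the spinors of one four-dimensional chirality.\<close>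

lemma half_spinor_asd_2:
  assumes "half_spinor x"
  shows "(\<Sum>m=1..5. \<Sum>n=1..5. instanton_coeff p q r m n *\<^sub>R (gamma_asym G [m,n] *v x)) = 0"
  unfolding sum_1_to_5
  by (simp add: instanton_coeff_def gamma_asym_2 gamma_sort half_spinor_relations[OF assms])

text \<open>\<open>H\<close> is \<open>e^5\<close> wedged with an anti-self-dual form. Sorting moves
  \<open>G 5\<close> to the front, and the cancellation is that of the two-form case.\<close>

lemma half_spinor_asd_3:
  fixes H :: "nat \<Rightarrow> nat \<Rightarrow> nat \<Rightarrow> real"
  assumes "half_spinor x"
    and H: "\<And>m n k. m \<in> {1..5} \<Longrightarrow> n \<in> {1..5} \<Longrightarrow> k \<in> {1..5} \<Longrightarrow> H m n k =
      (if m = 5 then instanton_coeff p q r n k else 0) - (if n = 5 then instanton_coeff p q r m k else 0)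
      + (if k = 5 then instanton_coeff p q r m n else 0)"
  shows "(\<Sum>m=1..5. \<Sum>n=1..5. \<Sum>k=1..5. H m n k *\<^sub>R (gamma_asym G [m,n,k] *v x)) = 0"
  unfolding sum_1_to_5
  by (simp add: H) (simp add: instanton_coeff_def gamma_asym_3 gamma_sort
      half_spinor_relations[OF assms(1)] matrix_vector_mult_minus_right)

end

section \<open>Pontrjagin forms and the flux\<close>

text \<open>Half of the value of \<open>\<alpha> \<and> \<alpha>\<close> when
  \<open>\<alpha>\<close> is antisymmetric.\<close>

definition pfaffian :: "('a \<Rightarrow> 'a \<Rightarrow> real) \<Rightarrow> 'a \<Rightarrow> 'a \<Rightarrow> 'a \<Rightarrow> 'a \<Rightarrow> real" where
  "pfaffian \<alpha> x y z w = \<alpha> x y * \<alpha> z w - \<alpha> x z * \<alpha> y w + \<alpha> x w * \<alpha> y z"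

definition minor :: "('a \<Rightarrow> real) \<Rightarrow> ('a \<Rightarrow> real) \<Rightarrow> 'a \<Rightarrow> 'a \<Rightarrow> real" where
  "minor f g u v = f u * g v - f v * g u"

text \<open>The value of \<open>(f\<^sub>1 \<and> f\<^sub>2) \<and> (f\<^sub>3 \<and> f\<^sub>4)\<close>, summed over the six \<open>(2,2)\<close>-shuffles.\<close>

definition volume :: "(nat \<Rightarrow> 'a \<Rightarrow> real) \<Rightarrow> 'a \<Rightarrow> 'a \<Rightarrow> 'a \<Rightarrow> 'a \<Rightarrow> real" where
  "volume f x y z w =
     minor (f 1) (f 2) x y * minor (f 3) (f 4) z w - minor (f 1) (f 2) x z * minor (f 3) (f 4) y w
   + minor (f 1) (f 2) x w * minor (f 3) (f 4) y z + minor (f 1) (f 2) y z * minor (f 3) (f 4) x w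
   - minor (f 1) (f 2) y w * minor (f 3) (f 4) x z + minor (f 1) (f 2) z w * minor (f 3) (f 4) x y"

text \<open>The Pluecker relation.\<close>

lemma pfaffian_decomposable: "pfaffian (\<lambda>u v. f u * g v - f v * g u) x y z w = 0"
  unfolding pfaffian_def by algebra

lemma pfaffian_scale: "pfaffian (\<lambda>u v. r * \<alpha> u v) x y z w = r\<^sup>2 * pfaffian \<alpha> x y z w"
  unfolding pfaffian_def by algebra

text \<open>Reduces the square of a two-form in \<open>f 1\<close> to \<open>f 4\<close> to the
  Pfaffian of its six coefficients.\<close>

lemma pfaffian_coordinates:
  "pfaffian (\<lambda>u v. A12 * minor (f 1) (f 2) u v + A13 * minor (f 1) (f 3) u v + A14 * minor (f 1) (f 4) u v
     + A23 * minor (f 2) (f 3) u v + A24 * minor (f 2) (f 4) u v + A34 * minor (f 3) (f 4) u v) x y z w =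
   (A12 * A34 - A13 * A24 + A14 * A23) * volume f x y z w"
  unfolding pfaffian_def volume_def minor_def by algebra

lemma wedge_self_pfaffian:
  assumes "\<And>u v. \<omega> p [v,u] = - \<omega> p [u,v]"
  shows "wedge 2 2 \<omega> \<omega> p [x,y,z,w] = 2 * pfaffian (\<lambda>u v. \<omega> p [u,v]) x y z w"
  unfolding wedge_2_2_self[of \<omega> p, OF assms] by (simp add: pfaffian_def)

context N21_frame
begin

abbreviation vol :: "coords \<Rightarrow> coords \<Rightarrow> coords \<Rightarrow> coords \<Rightarrow> coords \<Rightarrow> real" where
  "vol p \<equiv> volume (\<lambda>k v. e k p [v])"

abbreviation em :: "nat \<Rightarrow> nat \<Rightarrow> coords \<Rightarrow> coords \<Rightarrow> coords \<Rightarrow> real" where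
  "em i j p \<equiv> minor (\<lambda>v. e i p [v]) (\<lambda>v. e j p [v])"

lemma omega_minors:
  "omega u v = a * em 1 2 p u v + b * em 1 3 p u v + c * em 1 4 p u v
     + (- c) * em 2 3 p u v + b * em 2 4 p u v + (- a) * em 3 4 p u v"
  unfolding omega_eq[of u v p] e2_eq minor_def by algebra

lemma pfaffian_omega:
  "pfaffian omega x y z w = - (a\<^sup>2 + b\<^sup>2 + c\<^sup>2) * vol p x y z w"
proof -
  have "pfaffian omega x y z w = (a * (- a) - b * b + c * (- c)) * vol p x y z w"
    unfolding pfaffian_coordinates[symmetric] omega_minors[of _ _ p, symmetric] ..
  then show ?thesis by (simp add: power2_eq_square algebra_simps)
qed

lemma pontrjagin1_4:
  "pontrjagin1 e N p [x,y,z,w] = 1 / (4 * pi\<^sup>2) *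
     (\<Sum>j=1..5. \<Sum>i=1..<j. pfaffian (\<lambda>u v. curv_form e N i j p [u,v]) x y z w)"
  unfolding pontrjagin1_def
  by (simp add: wedge_self_pfaffian[where \<omega> = "curv_form e N i j" for i j, OF curv_form_swap] flip: sum_distrib_left)

text \<open>Each curvature form is a multiple of \<open>omega\<close>; among the pairs
  \<open>i < j\<close> each of \<open>lam\<close>, \<open>mu\<close>, \<open>tau\<close> occurs
  twice up to sign, whence the factor 2.\<close>

lemma pontrjagin1_instanton:
  assumes "instanton_connection e lam mu tau A"
  shows "pontrjagin1 e A p [x,y,z,w] = 1 / (4 * pi\<^sup>2) *
    (- 2 * (lam\<^sup>2 + mu\<^sup>2 + tau\<^sup>2) * (a\<^sup>2 + b\<^sup>2 + c\<^sup>2) * vol p x y z w)"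
proof -
  have "pfaffian (\<lambda>u v. curv_form e A i j p [u,v]) x y z w =
      (instanton_coeff lam mu tau i j)\<^sup>2 * (- (a\<^sup>2 + b\<^sup>2 + c\<^sup>2) * vol p x y z w)"
    if "i \<in> {1..5}" "j \<in> {1..5}" for i j
    unfolding curv_form_instanton[OF assms that] pfaffian_scale pfaffian_omega[of x y z w p] ..
  then show ?thesis
    unfolding pontrjagin1_4 sum_pairs_below_5
    by (simp add: instanton_coeff_def) (simp add: field_simps)
qed

text \<open>\<open>A k l\<close> is the coefficient of \<open>e^k \<and> e^l\<close> in the
  curvature form. Its defining equation is a hypothesis so that \<open>refl\<close> can instantiate
  it for each pair.\<close>

lemma pfaffian_curv_form_levi_civita:
  assumes LC: "levi_civita (coframe_metric e) N" and ij: "i \<in> {1..4}" "j \<in> {1..4}"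
    and A: "\<And>k l. A k l = 1/2 * Om j i * Om k l - 1/4 * (Om k i * Om l j - Om l i * Om k j)"
  shows "pfaffian (\<lambda>u v. curv_form e N i j p [u,v]) x y z w =
    (A 1 2 * A 3 4 - A 1 3 * A 2 4 + A 1 4 * A 2 3) * vol p x y z w"
proof -
  have w: "omega u v = Om 1 2 * em 1 2 p u v + Om 1 3 * em 1 3 p u v + Om 1 4 * em 1 4 p u v
     + Om 2 3 * em 2 3 p u v + Om 2 4 * em 2 4 p u v + Om 3 4 * em 3 4 p u v" for u v
    unfolding omega_minors[of u v p] by (simp add: Om_def instanton_coeff_def)
  have "curv_form e N i j p [u,v] = A 1 2 * em 1 2 p u v + A 1 3 * em 1 3 p u v + A 1 4 * em 1 4 p u v
     + A 2 3 * em 2 3 p u v + A 2 4 * em 2 4 p u v + A 3 4 * em 3 4 p u v" for u v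
    unfolding curv_form_levi_civita[OF LC ij] theta_def sum_1_to_5 w A Om_5 minor_def
    by (simp add: algebra_simps)
  then show ?thesis
    by (simp only: pfaffian_coordinates[where f = "\<lambda>k v. e k p [v]"])
qed

text \<open>With \<open>s = a\<^sup>2 + b\<^sup>2 + c\<^sup>2\<close>, the squares of the
  \<open>omega\<close> parts sum to \<open>- s\<^sup>2 / 2\<close> and the cross terms with the
  \<open>theta\<close> parts to \<open>- s\<^sup>2 / 4\<close>; the pure \<open>theta\<close> parts
  and the pairs with index 5 are decomposable.\<close>

lemma pontrjagin1_levi_civita:
  assumes "levi_civita (coframe_metric e) N"
  shows "pontrjagin1 e N p [x,y,z,w] =
    1 / (4 * pi\<^sup>2) * (- (3/4) * (a\<^sup>2 + b\<^sup>2 + c\<^sup>2)\<^sup>2 * vol p x y z w)"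
proof -
  have zero: "pfaffian (\<lambda>u v. curv_form e N i 5 p [u,v]) x y z w = 0" if i: "i \<in> {1..4}" for i
  proof -
    obtain \<kappa> where "\<And>u v. curv_form e N i 5 p [u,v] = e 5 p [u] * \<kappa> v - e 5 p [v] * \<kappa> u"
      using curv_form_levi_civita_5[OF assms i, of p] by blast
    then show ?thesis
      by (simp only: pfaffian_decomposable[of "\<lambda>v. e 5 p [v]"])
  qed
  have "(\<Sum>j=1..5. \<Sum>i=1..<j. pfaffian (\<lambda>u v. curv_form e N i j p [u,v]) x y z w) =
      - (3/4) * (a\<^sup>2 + b\<^sup>2 + c\<^sup>2)\<^sup>2 * vol p x y z w"
    unfolding sum_pairs_below_5
    by (simp add: zero pfaffian_curv_form_levi_civita[OF assms _ _ refl] Om_def instanton_coeff_def)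
      (simp add: field_simps power2_eq_square)
  then show ?thesis unfolding pontrjagin1_4 by simp
qed

lemma pontrjagin1_length: "length vs \<noteq> 4 \<Longrightarrow> pontrjagin1 e N p vs = 0"
  by (simp add: pontrjagin1_def wedge_eq_0)

section \<open>The flux and the connection with torsion\<close>

abbreviation (input) torsion :: "coords form" where
  "torsion \<equiv> wedge 1 2 (e 5) (ext_d (e 5))"

lemma torsion_eq: "torsion p [x,y,z] = e 5 p [x] * omega y z - e 5 p [y] * omega x z + e 5 p [z] * omega x y"
  by (simp only: wedge_1_2[of "ext_d (e 5)" p, unfolded ext_d_e5, OF omega_swap])

text \<open>As \<open>omega\<close> is constant in the chart, only the \<open>e 5\<close> factors
  are differentiated, so the derivative is \<open>de^5 \<and> de^5\<close>.\<close>

lemma ext_d_torsion_4: "ext_d torsion p [x,y,z,w] = - 2 * (a\<^sup>2 + b\<^sup>2 + c\<^sup>2) * vol p x y z w"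
proof -
  have d: "frechet_derivative (\<lambda>q. torsion q [x,y,z]) (at p) h = - (e 5 0 [twist h x] * omega y z
    - e 5 0 [twist h y] * omega x z + e 5 0 [twist h z] * omega x y)" for x y z h
  proof -
    have "((\<lambda>q. torsion q [x,y,z]) has_derivative (\<lambda>h. (- e 5 0 [twist h x]) * omega y z
      - (- e 5 0 [twist h y]) * omega x z + (- e 5 0 [twist h z]) * omega x y)) (at p)"
      unfolding torsion_eq by (intro derivative_intros e_has_derivative) auto
    from fun_cong[OF frechet_derivative_at[OF this], of h] show ?thesis by simp
  qed
  have "ext_d torsion p [x,y,z,w] = 2 * pfaffian omega x y z w"
    unfolding ext_d_4[of torsion] d pfaffian_def omega_def by algebra
  then show ?thesis by (simp add: pfaffian_omega[of x y z w p])
qed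

lemma ext_d_torsion_length: "length vs \<noteq> 4 \<Longrightarrow> ext_d torsion p vs = 0"
  unfolding ext_d_def by (intro sum.neutral ballI) (auto simp: wedge_eq_0)

text \<open>All three four-forms are multiples of \<open>vol p\<close>, so the claim is an identity
  between scalars; on lists of other lengths both sides vanish.\<close>

lemma ext_d_torsion:
  assumes LC: "levi_civita (coframe_metric e) N" and A: "instanton_connection e lam mu tau A"
    and ne: "3 * (a\<^sup>2 + b\<^sup>2 + c\<^sup>2) - 8 * (lam\<^sup>2 + mu\<^sup>2 + tau\<^sup>2) \<noteq> 0"
    and r: "r = 16 * inverse (3 * (a\<^sup>2 + b\<^sup>2 + c\<^sup>2) - 8 * (lam\<^sup>2 + mu\<^sup>2 + tau\<^sup>2))"
  shows "ext_d torsion p vs = 2 * pi\<^sup>2 * r * (pontrjagin1 e N p vs - pontrjagin1 e A p vs)"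
proof (cases "length vs = 4")
  case True
  then obtain x y z w where vs: "vs = [x,y,z,w]"
    by (auto simp: length_Suc_conv numeral_eq_Suc)
  define s L where "s = a\<^sup>2 + b\<^sup>2 + c\<^sup>2" and "L = lam\<^sup>2 + mu\<^sup>2 + tau\<^sup>2"
  have "r * (3 * s - 8 * L) = 16"
    using ne by (simp add: r s_def L_def)
  \<comment> \<open>Multiplying \<open>r * (3 * s - 8 * L) = 16\<close> by \<open>- s / 8\<close>
    matches the coefficients.\<close>
  then have "- 2 * s = r * (3 * s - 8 * L) * (- s / 8)" by simp
  also have "\<dots> = 1/2 * r * (- (3/4) * s\<^sup>2 - (- 2 * L * s))"
    by (simp add: power2_eq_square algebra_simps)
  finally have *: "- 2 * s = 1/2 * r * (- (3/4) * s\<^sup>2 - (- 2 * L * s))" .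
  have "ext_d torsion p vs = - 2 * s * vol p x y z w"
    unfolding vs ext_d_torsion_4 s_def ..
  also have "\<dots> = 2 * pi\<^sup>2 * r * (1 / (4 * pi\<^sup>2) * (- (3/4) * s\<^sup>2 * vol p x y z w) -
      1 / (4 * pi\<^sup>2) * (- 2 * L * s * vol p x y z w))"
    unfolding * by (simp add: field_simps)
  finally show ?thesis
    unfolding vs pontrjagin1_levi_civita[OF LC] pontrjagin1_instanton[OF A] s_def L_def .
qed (simp add: ext_d_torsion_length pontrjagin1_length)

text \<open>The contraction terms of \<open>levi_civita_form\<close> cancel against half the
  torsion, while the two halves of the \<open>e 5\<close> term add up.\<close>

lemma nabla_plus_form:
  assumes LC: "levi_civita (coframe_metric e) N" and j: "j \<in> {1..5}" and k: "k \<in> {1..5}"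
  shows "e k p [nabla_plus (coframe_metric e) torsion N (\<lambda>_. v) (E j) p] = e 5 p [v] * Om j k"
proof -
  let ?g = "coframe_metric e p" and ?u = "N (\<lambda>_. v) (E j) p"
  let ?P = "\<lambda>w. \<forall>z. ?g w z = ?g ?u z + 1/2 * torsion p [v, E j p, z]"
  have lin: "linear (\<lambda>z. torsion p [v, E j p, z])"
    unfolding torsion_eq
    by (rule linearI) (simp_all add: e_add e_scale linear_add[OF linear_omega_right]
      linear_scale[OF linear_omega_right] algebra_simps)
  \<comment> \<open>The torsion term enters through its metric dual, expanded in the orthonormal
    frame.\<close>
  define w where "w = ?u + (\<Sum>l=1..5. (1/2 * torsion p [v, E j p, E l p]) *\<^sub>R E l p)"
  have "?P w"
  proof
    fix z
    have "torsion p [v, E j p, z] = (\<Sum>l=1..5. e l p [z] * torsion p [v, E j p, E l p])"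
      by (subst frame_expansion[of z p]) (simp add: linear_sum[OF lin] linear_scale[OF lin])
    moreover have "e i p [w] = e i p [?u] + 1/2 * torsion p [v, E j p, E i p]" if "i \<in> {1..5}" for i
      using that
      by (simp add: w_def e_add e_sum e_scale e_dual if_distrib sum.delta cong: if_cong)
    ultimately show "?g w z = ?g ?u z + 1/2 * torsion p [v, E j p, z]"
      by (simp add: coframe_metric_def sum_distrib_left algebra_simps flip: sum.distrib)
  qed
  moreover have "w' = w" if "?P w'" for w'
  proof (rule e_eqI[of p])
    fix k :: nat assume "k \<in> {1..5}"
    then show "e k p [w'] = e k p [w]"
      using \<open>?P w\<close> \<open>?P w'\<close> metric_frame by metis
  qed
  ultimately have "?P (THE w. ?P w)" by (rule theI[of ?P])
  then have "?g (nabla_plus (coframe_metric e) torsion N (\<lambda>_. v) (E j) p) (E k p) =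
      ?g ?u (E k p) + 1/2 * torsion p [v, E j p, E k p]"
    unfolding nabla_plus_def by blast
  then show ?thesis
    using j k levi_civita_form[OF LC j k, of p v]
    by (cases "j = 5"; cases "k = 5") (simp_all add: metric_frame torsion_eq e_dual omega_frame)
qed

lemma Om_swap:
  assumes "i \<in> {1..5}" "j \<in> {1..5}"
  shows "Om j i = - Om i j"
proof -
  have "\<forall>i\<in>{1..5}. \<forall>j\<in>{1..5}. Om j i = - Om i j"
    unfolding ball_1_to_5 by (simp add: Om_def instanton_coeff_def)
  then show ?thesis using assms by blast
qed

lemma conn_form_nabla_plus:
  assumes "levi_civita (coframe_metric e) N" "i \<in> {1..5}" "j \<in> {1..5}"
  shows "conn_form e (nabla_plus (coframe_metric e) torsion N) i j p [v] =
    (- e 5 p [v]) * Om i j"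
  using nabla_plus_form[OF assms(1,3,2), of p v] by (simp add: conn_form_def Om_swap[OF assms(2,3)])

end

section \<open>The supersymmetry equations\<close>

locale N21_spinor = N21_frame + clifford_module
begin

text \<open>The common core of the gravitino and gaugino equations: both act on the spinor through a
  scalar multiple of \<open>Om\<close>.\<close>

lemma half_spinor_omega:
  assumes "half_spinor x"
  shows "(\<Sum>m=1..5. \<Sum>n=1..5. (r * Om m n) *\<^sub>R (gamma_asym G [m,n] *v x)) = 0"
proof -
  have "(\<Sum>m=1..5. \<Sum>n=1..5. (r * Om m n) *\<^sub>R (gamma_asym G [m,n] *v x)) =
    r *\<^sub>R (\<Sum>m=1..5. \<Sum>n=1..5. Om m n *\<^sub>R (gamma_asym G [m,n] *v x))"
    by (simp add: scaleR_sum_right)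
  then show ?thesis by (simp add: Om_def half_spinor_asd_2[OF assms])
qed

text \<open>For a constant spinor only the connection term of \<open>spin_deriv\<close> is
  left.\<close>

lemma gravitino:
  assumes "levi_civita (coframe_metric e) N" "half_spinor x"
  shows "gravitino_eq e G N torsion (\<lambda>_. x)"
  unfolding gravitino_eq_def
proof (intro allI)
  fix p v
  have "(\<Sum>i=1..5. \<Sum>j=1..5. conn_form e (nabla_plus (coframe_metric e) torsion N) i j p [v]
        *\<^sub>R (gamma_asym G [i, j] *v x)) =
    (\<Sum>i=1..5. \<Sum>j=1..5. ((- e 5 p [v]) * Om i j) *\<^sub>R (gamma_asym G [i,j] *v x))"
    by (intro sum.cong refl) (simp add: conn_form_nabla_plus[OF assms(1)])
  then show "spin_deriv e G (nabla_plus (coframe_metric e) torsion N) (\<lambda>_. x) p v = 0"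
    unfolding spin_deriv_def half_spinor_omega[OF assms(2)] by simp
qed

lemma gaugino:
  assumes "instanton_connection e lam mu tau A" "half_spinor x"
  shows "gaugino_eq e G A (\<lambda>_. x)"
  unfolding gaugino_eq_def
proof (intro allI ballI)
  fix p and i j :: nat assume ij: "i \<in> {1..5}" "j \<in> {1..5}"
  have "(\<Sum>m=1..5. \<Sum>n=1..5. curv_form e A i j p [E m p, E n p] *\<^sub>R gamma_asym G [m, n]) *v x =
    (\<Sum>m=1..5. \<Sum>n=1..5. (instanton_coeff lam mu tau i j * Om m n) *\<^sub>R (gamma_asym G [m,n] *v x))"
    unfolding sum_matrix_vector_mult scaleR_matrix_vector_mult
    by (intro sum.cong refl) (simp add: curv_form_instanton[OF assms(1) ij] omega_frame)
  then show "(\<Sum>m=1..5. \<Sum>n=1..5. curv_form e A i j p [E m p, E n p] *\<^sub>R gamma_asym G [m, n]) *v x = 0"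
    unfolding half_spinor_omega[OF assms(2)] .
qed

text \<open>\<open>phi\<close> is constant on \<open>N21\<close>, where \<open>proj\<close> takes
  its values, so the gradient term vanishes; the flux term is the three-form case of the
  cancellation.\<close>

lemma dilatino:
  assumes "\<And>x. x \<in> N21 \<Longrightarrow> phi x = k" "half_spinor x"
  shows "dilatino_eq e G phi torsion (\<lambda>_. x)"
  unfolding dilatino_eq_def
proof
  fix p
  have phi: "(\<lambda>q. phi (proj q)) = (\<lambda>_. k)" using assms(1) proj_in_N21 by blast
  have "(\<Sum>m=1..5. \<Sum>n=1..5. \<Sum>k=1..5. torsion p [E m p, E n p, E k p] *\<^sub>R (gamma_asym G [m, n, k] *v x)) = 0"
    by (rule half_spinor_asd_3[OF assms(2), of _ "-a" "-b" "-c"])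
      (auto simp: torsion_eq e_dual omega_frame Om_def)
  then show "((\<Sum>m=1..5. frechet_derivative (\<lambda>q. phi (proj q)) (at p) (E m p) *\<^sub>R G m) -
      (1/12) *\<^sub>R (\<Sum>m=1..5. \<Sum>n=1..5. \<Sum>k=1..5.
         torsion p [E m p, E n p, E k p] *\<^sub>R gamma_asym G [m, n, k])) *v x = 0"
    unfolding phi matrix_vector_mult_diff_rdistrib scaleR_matrix_vector_mult sum_matrix_vector_mult
    by simp
qed

end

theorem proposition4p5:
  fixes a b c lam mu tau alpha' :: real
    and e :: "nat \<Rightarrow> coords form"
    and eta F1 F2 F3 T :: "coords form"
    and nabg A :: "coords connection"
    and phi :: "(real^4^4) set \<Rightarrow> real"
    and G :: "nat \<Rightarrow> complex^4^4"
  assumes abc: "(a, b, c) \<noteq> (0, 0, 0)"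
    and coframe: "N21_coframe a b c e"
    and SU2: "su2_adapted e eta F1 F2 F3"
    and T_eq: "T = wedge 1 2 eta (ext_d eta)"
    and LC: "levi_civita (coframe_metric e) nabg"
    and A: "instanton_connection e lam mu tau A"
    and nonzero: "(lam, mu, tau) \<noteq> (0, 0, 0)"
    and bound: "lam\<^sup>2 + mu\<^sup>2 + tau\<^sup>2 < 3/8 * (a\<^sup>2 + b\<^sup>2 + c\<^sup>2)"
    and alpha'_eq: "alpha' = 16 * inverse (3 * (a\<^sup>2 + b\<^sup>2 + c\<^sup>2) - 8 * (lam\<^sup>2 + mu\<^sup>2 + tau\<^sup>2))"
    and gamma: "gamma_matrices G"
    and dilaton: "\<exists>k. \<forall>x\<in>N21. phi x = k"
  shows "alpha' > 0 \<and>
    (\<forall>p vs. ext_d T p vs =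
       2 * pi\<^sup>2 * alpha' * (pontrjagin1 e nabg p vs - pontrjagin1 e A p vs)) \<and>
    compact_heterotic_solution e eta F1 F2 F3 A nabg nabg T phi alpha' G"
proof -
  interpret N21_spinor a b c e G by unfold_locales (fact coframe, fact gamma)
  have T: "T = wedge 1 2 (e 5) (ext_d (e 5))"
    using T_eq SU2 by (simp add: su2_adapted_def)
  have pos: "3 * (a\<^sup>2 + b\<^sup>2 + c\<^sup>2) - 8 * (lam\<^sup>2 + mu\<^sup>2 + tau\<^sup>2) > 0"
    using bound by simp
  then have "alpha' > 0" by (simp add: alpha'_eq)
  moreover have dT: "ext_d T p vs =
      2 * pi\<^sup>2 * alpha' * (pontrjagin1 e nabg p vs - pontrjagin1 e A p vs)" for p vs
    unfolding T using ext_d_torsion[OF LC A _ alpha'_eq] pos by simp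
  moreover have "compact_heterotic_solution e eta F1 F2 F3 A nabg nabg T phi alpha' G"
  proof -
    obtain k where k: "\<And>x. x \<in> N21 \<Longrightarrow> phi x = k" using dilaton by blast
    \<comment> \<open>The constant field with value \<open>x\<close> is the spinor for all three
      equations.\<close>
    obtain x where x: "x \<noteq> 0" "half_spinor x" using half_spinor_exists by blast
    have "linear_connection nabg" "linear_connection A"
      using LC A by (simp_all add: levi_civita_def instanton_connection_def)
    moreover have "smooth (\<lambda>p. phi (proj p))"
      using k[OF proj_in_N21] by (simp add: smooth_const)
    moreover have "\<exists>eps :: spinor. smooth (\<lambda>p. eps (proj p)) \<and> (\<forall>x\<in>N21. eps x \<noteq> 0) \<and>
        gravitino_eq e G nabg T eps \<and> dilatino_eq e G phi T eps \<and> gaugino_eq e G A eps"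
      using gravitino[OF LC x(2)] dilatino[OF k x(2)] gaugino[OF A x(2)] x(1)
      by (intro exI[of _ "\<lambda>_. x"]) (simp add: smooth_const T)
    moreover have "ext_d T p vs =
        alpha' / 4 * (8 * pi\<^sup>2) * (pontrjagin1 e nabg p vs - pontrjagin1 e A p vs)" for p vs
      by (simp add: dT)
    ultimately show ?thesis
      unfolding compact_heterotic_solution_def
      using SU2 LC topspace_N21 compact_N21 by blast
  qed
  ultimately show ?thesis by blast
qed

end
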